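(* Let $\tilde D=S(\tilde V)$ be the commutative algebra generated by the couples $(t,s)$, where $t$ is a rooted tree and $s$ is a subforest of $t$, with product $(t,s)(t',s')=(tt',ss')$. Let $\Gamma:\tilde D\to\tilde D\otimes\tilde D$ be given by $$\Gamma(t,s)=\sum_{s'\subseteq s}(t,s')\otimes(t/s',s/s').$$ Then $\tilde D$, with this product, the coproduct $\Gamma$, the unit $\mathbf 1$ identified with the empty forest, the counit $\varepsilon(t,s)=\varepsilon(s)$, and the grading by the number of edges of $s$, is a graded bialgebra.
   Context: Work over a fixed base field. A rooted tree is a finite connected simply connected oriented graph in which every vertex has exactly one incoming edge, except a distinguished vertex (the root) which has none; a rooted forest is a finite (possibly empty) disjoint union of rooted trees; trees and forests are taken up to isomorphism. The product of forests is disjoint union (concatenation) and $\mathbf 1$ denotes the empty forest. A subforest $s$ of a tree (or forest) $t$ is a (possibly empty) collection of pairwise vertex-disjoint subtrees of $t$; it is a covering subforest of $t$ if every vertex of $t$ belongs to one of these subtrees (single-vertex subtrees are allowed). In the sum defining $\Gamma$, $s'\subseteq s$ runs over the covering subforests of $s$. If $s'$ is a subforest of $t$, $t/s'$ is the tree (or forest) obtained from $t$ by contracting each connected component of $s'$ onto a vertex; similarly $s/s'$, which is regarded as a subforest of $t/s'$. $\tilde V$ is the vector space spanned by couples $(t,s)$ with $t$ a rooted tree and $s$ a subforest of $t$ (the couple $(\mathbf 1,\mathbf 1)$ is allowed and is identified with the unit of $\tilde D$); $s$ is remembered as a subforest of $t$ and couples are taken up to isomorphism of couples. $\Gamma$ is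 extended to $\tilde D=S(\tilde V)$ multiplicatively. The counit on forests used here is the one of the bialgebra of rooted forests with the contraction coproduct $t\mapsto\sum_{s\subseteq t}s\otimes t/s$: $\varepsilon(s)=1$ if $s$ has no edge, and $\varepsilon(s)=0$ otherwise; on $\tilde D$ it is extended multiplicatively. *)

theory Defs
  imports
    "HOL-Library.Poly_Mapping"
    "HOL-Library.Multiset"
    "HOL-Library.Product_Plus"
    "Graph_Theory.Digraph_Component"
begin

section \<open>Graded bialgebras on free vector spaces\<close>

text \<open>
  The vector space with basis \<open>'x\<close> over the field \<open>'k\<close> is \<open>'x \<Rightarrow>\<^sub>0 'k\<close>. The tensor product of the
  spaces with bases \<open>'x\<close> and \<open>'y\<close> is the space \<open>'x \<times> 'y \<Rightarrow>\<^sub>0 'k\<close>, with \<open>tensor a b\<close> in the role of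
  \<open>a \<otimes> b\<close>.
\<close>

definition scale :: "'k \<Rightarrow> ('x \<Rightarrow>\<^sub>0 'k) \<Rightarrow> ('x \<Rightarrow>\<^sub>0 'k::field)" where
  "scale c = Poly_Mapping.map ((*) c)"

definition basis :: "'x \<Rightarrow> ('x \<Rightarrow>\<^sub>0 'k::field)" where
  "basis x = Poly_Mapping.single x 1"

definition lin_ext :: "('k \<Rightarrow> 'v \<Rightarrow> 'v) \<Rightarrow> ('x \<Rightarrow> 'v) \<Rightarrow> ('x \<Rightarrow>\<^sub>0 'k::field) \<Rightarrow> 'v::comm_monoid_add" where
  "lin_ext sc f p = (\<Sum>x\<in>Poly_Mapping.keys p. sc (Poly_Mapping.lookup p x) (f x))"

definition tensor :: "('x \<Rightarrow>\<^sub>0 'k) \<Rightarrow> ('y \<Rightarrow>\<^sub>0 'k) \<Rightarrow> ('x \<times> 'y \<Rightarrow>\<^sub>0 'k::field)" where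
  "tensor a b = lin_ext scale (\<lambda>x. lin_ext scale (\<lambda>y. basis (x, y)) b) a"

text \<open>For linear maps \<open>f\<close> and \<open>g\<close>, this is \<open>f \<otimes> g\<close>.\<close>

definition tensor_map ::
  "(('x \<Rightarrow>\<^sub>0 'k) \<Rightarrow> ('x' \<Rightarrow>\<^sub>0 'k)) \<Rightarrow> (('y \<Rightarrow>\<^sub>0 'k) \<Rightarrow> ('y' \<Rightarrow>\<^sub>0 'k)) \<Rightarrow>
   ('x \<times> 'y \<Rightarrow>\<^sub>0 'k) \<Rightarrow> ('x' \<times> 'y' \<Rightarrow>\<^sub>0 'k::field)" where
  "tensor_map f g = lin_ext scale (\<lambda>(x, y). tensor (f (basis x)) (g (basis y)))"

definition tensor_assoc :: "(('x \<times> 'y) \<times> 'z \<Rightarrow>\<^sub>0 'k) \<Rightarrow> ('x \<times> ('y \<times> 'z) \<Rightarrow>\<^sub>0 'k::field)" where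
  "tensor_assoc = lin_ext scale (\<lambda>((x, y), z). basis (x, (y, z)))"

text \<open>
  For a linear form \<open>e\<close>, these are \<open>e \<otimes> id\<close> and \<open>id \<otimes> e\<close> followed by the identifications of
  \<open>'k \<otimes> V\<close> and \<open>V \<otimes> 'k\<close> with \<open>V\<close>.
\<close>

definition form_left :: "(('x \<Rightarrow>\<^sub>0 'k) \<Rightarrow> 'k) \<Rightarrow> ('x \<times> 'y \<Rightarrow>\<^sub>0 'k) \<Rightarrow> ('y \<Rightarrow>\<^sub>0 'k::field)" where
  "form_left e = lin_ext scale (\<lambda>(x, y). scale (e (basis x)) (basis y))"

definition form_right :: "(('y \<Rightarrow>\<^sub>0 'k) \<Rightarrow> 'k) \<Rightarrow> ('x \<times> 'y \<Rightarrow>\<^sub>0 'k) \<Rightarrow> ('x \<Rightarrow>\<^sub>0 'k::field)" where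
  "form_right e = lin_ext scale (\<lambda>(x, y). scale (e (basis y)) (basis x))"

text \<open>The product \<open>(a \<otimes> b)(c \<otimes> d) = ac \<otimes> bd\<close> induced by a bilinear product \<open>m\<close>.\<close>

definition tensor_mult ::
  "(('x \<Rightarrow>\<^sub>0 'k) \<Rightarrow> ('x \<Rightarrow>\<^sub>0 'k) \<Rightarrow> ('x \<Rightarrow>\<^sub>0 'k)) \<Rightarrow>
   ('x \<times> 'x \<Rightarrow>\<^sub>0 'k) \<Rightarrow> ('x \<times> 'x \<Rightarrow>\<^sub>0 'k) \<Rightarrow> ('x \<times> 'x \<Rightarrow>\<^sub>0 'k::field)" where
  "tensor_mult m P Q =
     lin_ext scale (\<lambda>(a, b).
       lin_ext scale (\<lambda>(c, d). tensor (m (basis a) (basis c)) (m (basis b) (basis d))) Q) P"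

locale unital_algebra =
  fixes m :: "('x \<Rightarrow>\<^sub>0 'k::field) \<Rightarrow> ('x \<Rightarrow>\<^sub>0 'k) \<Rightarrow> ('x \<Rightarrow>\<^sub>0 'k)"
    and u :: "'x \<Rightarrow>\<^sub>0 'k"
  assumes m_linear_right: "Vector_Spaces.linear scale scale (\<lambda>b. m a b)"
    and m_linear_left: "Vector_Spaces.linear scale scale (\<lambda>a. m a b)"
    and m_assoc: "m (m a b) c = m a (m b c)"
    and m_unit_left: "m u a = a"
    and m_unit_right: "m a u = a"

locale counital_coalgebra =
  fixes \<Delta> :: "('x \<Rightarrow>\<^sub>0 'k::field) \<Rightarrow> ('x \<times> 'x \<Rightarrow>\<^sub>0 'k)"
    and \<epsilon> :: "('x \<Rightarrow>\<^sub>0 'k) \<Rightarrow> 'k"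
  assumes comult_linear: "Vector_Spaces.linear scale scale \<Delta>"
    and counit_linear: "Vector_Spaces.linear scale (*) \<epsilon>"
    and coassoc: "tensor_assoc (tensor_map \<Delta> id (\<Delta> a)) = tensor_map id \<Delta> (\<Delta> a)"
    and counit_left: "form_left \<epsilon> (\<Delta> a) = a"
    and counit_right: "form_right \<epsilon> (\<Delta> a) = a"

locale bialgebra = unital_algebra m u + counital_coalgebra \<Delta> \<epsilon>
  for m :: "('x \<Rightarrow>\<^sub>0 'k::field) \<Rightarrow> ('x \<Rightarrow>\<^sub>0 'k) \<Rightarrow> ('x \<Rightarrow>\<^sub>0 'k)" and u \<Delta> \<epsilon> +
  assumes comult_unit: "\<Delta> u = tensor u u"
    and comult_mult: "\<Delta> (m a b) = tensor_mult m (\<Delta> a) (\<Delta> b)"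
    and counit_unit: "\<epsilon> u = 1"
    and counit_mult: "\<epsilon> (m a b) = \<epsilon> a * \<epsilon> b"

locale graded_bialgebra = bialgebra m u \<Delta> \<epsilon>
  for m :: "('x \<Rightarrow>\<^sub>0 'k::field) \<Rightarrow> ('x \<Rightarrow>\<^sub>0 'k) \<Rightarrow> ('x \<Rightarrow>\<^sub>0 'k)" and u \<Delta> \<epsilon> +
  fixes G :: "nat \<Rightarrow> ('x \<Rightarrow>\<^sub>0 'k) set"
  assumes G_subspace: "module.subspace scale (G n)"
    and G_direct_sum:
      "\<exists>!q. (\<forall>n. q n \<in> G n) \<and> finite {n. q n \<noteq> 0} \<and> a = (\<Sum>n | q n \<noteq> 0. q n)"
    and G_unit: "u \<in> G 0"
    and G_mult: "a \<in> G i \<Longrightarrow> b \<in> G j \<Longrightarrow> m a b \<in> G (i + j)"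
    and G_comult: "a \<in> G n \<Longrightarrow>
      \<Delta> a \<in> module.span scale (\<Union>i\<le>n. {tensor b c | b c. b \<in> G i \<and> c \<in> G (n - i)})"
    and G_counit: "a \<in> G n \<Longrightarrow> n > 0 \<Longrightarrow> \<epsilon> a = 0"


section \<open>Rooted trees, subforests and contraction\<close>

text \<open>
  A connected graph is simply connected (has no cycle, regardless of orientation) when each of its
  arcs is a bridge. The predicate \<^const>\<open>tree\<close> only excludes directed cycles.
\<close>

definition simply_connected_digraph :: "('a, 'b) pre_digraph \<Rightarrow> bool" where
  "simply_connected_digraph G \<longleftrightarrow>
     connected G \<and> (\<forall>e\<in>arcs G. \<not> connected (pre_digraph.del_arc G e))"

definition rooted_tree :: "'a pair_pre_digraph \<Rightarrow> bool" where
  "rooted_tree t \<longleftrightarrow>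
     pair_fin_digraph t \<and> simply_connected_digraph (with_proj t) \<and>
     (\<exists>r\<in>pverts t. in_degree (with_proj t) r = 0 \<and>
        (\<forall>v\<in>pverts t - {r}. in_degree (with_proj t) v = 1))"

definition root_of :: "'a pair_pre_digraph \<Rightarrow> 'a" where
  "root_of t = (THE r. r \<in> pverts t \<and> in_degree (with_proj t) r = 0)"

text \<open>A forest is given as the set of its trees.\<close>

definition rooted_forest :: "'a pair_pre_digraph set \<Rightarrow> bool" where
  "rooted_forest s \<longleftrightarrow>
     finite s \<and> (\<forall>T\<in>s. rooted_tree T) \<and> pairwise (\<lambda>T T'. disjnt (pverts T) (pverts T')) s"

definition subforest :: "'a pair_pre_digraph set \<Rightarrow> 'a pair_pre_digraph set \<Rightarrow> bool" where
  "subforest s f \<longleftrightarrow>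
     rooted_forest s \<and> (\<forall>T\<in>s. \<exists>T'\<in>f. subgraph (with_proj T) (with_proj T'))"

definition covering_subforest :: "'a pair_pre_digraph set \<Rightarrow> 'a pair_pre_digraph set \<Rightarrow> bool" where
  "covering_subforest s f \<longleftrightarrow> subforest s f \<and> \<Union> (pverts ` s) = \<Union> (pverts ` f)"

text \<open>Contracting a component of \<open>s\<close> keeps its root as the resulting vertex.\<close>

definition collapse :: "'a pair_pre_digraph set \<Rightarrow> 'a \<Rightarrow> 'a" where
  "collapse s v =
     (if \<exists>T\<in>s. v \<in> pverts T then root_of (THE T. T \<in> s \<and> v \<in> pverts T) else v)"

definition contract :: "'a pair_pre_digraph set \<Rightarrow> 'a pair_pre_digraph \<Rightarrow> 'a pair_pre_digraph" where
  "contract s t =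
     \<lparr> pverts = collapse s ` pverts t,
       parcs = map_prod (collapse s) (collapse s) ` (parcs t - \<Union> (parcs ` s)) \<rparr>"


section \<open>Couples up to isomorphism\<close>

text \<open>
  Vertices are taken in \<^typ>\<open>nat\<close>, which loses nothing up to isomorphism. The couple
  \<open>(\<one>, \<one>)\<close> is not included: it is identified with the unit of the algebra generated by the couples.
\<close>

type_synonym raw_couple = "nat pair_pre_digraph \<times> nat pair_pre_digraph set"

definition is_couple :: "raw_couple \<Rightarrow> bool" where
  "is_couple = (\<lambda>(t, s). rooted_tree t \<and> subforest s {t})"

definition map_digraph :: "('a \<Rightarrow> 'b) \<Rightarrow> 'a pair_pre_digraph \<Rightarrow> 'b pair_pre_digraph" where
  "map_digraph f t = \<lparr> pverts = f ` pverts t, parcs = map_prod f f ` parcs t \<rparr>"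

definition couple_iso :: "raw_couple \<Rightarrow> raw_couple \<Rightarrow> bool" where
  "couple_iso = (\<lambda>(t, s) (t', s').
     is_couple (t, s) \<and> is_couple (t', s') \<and>
     (\<exists>f. inj_on f (pverts t) \<and> map_digraph f t = t' \<and> map_digraph f ` s = s'))"

lemma map_digraph_id: "map_digraph id t = t"
  by (cases t) (simp add: map_digraph_def map_prod.id)

lemma map_digraph_comp: "map_digraph g (map_digraph f t) = map_digraph (g \<circ> f) t"
  by (simp add: map_digraph_def image_comp map_prod.comp)

lemma map_digraph_cong_id:
  assumes "pair_wf_digraph t" "\<And>v. v \<in> pverts t \<Longrightarrow> f v = v"
  shows "map_digraph f t = t"
proof -
  have "map_prod f f e = e" if "e \<in> parcs t" for e
    using that assms pair_wf_digraph.arc_fst_in_verts[OF assms(1) that]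
      pair_wf_digraph.arc_snd_in_verts[OF assms(1) that] by (cases e) auto
  then show ?thesis
    using assms(2) by (cases t) (simp add: map_digraph_def)
qed

lemma is_couple_wf: "is_couple (t, s) \<Longrightarrow> T \<in> insert t s \<Longrightarrow> pair_wf_digraph T"
  by (auto simp: is_couple_def subforest_def rooted_forest_def rooted_tree_def pair_fin_digraph_def)

lemma is_couple_verts: "is_couple (t, s) \<Longrightarrow> T \<in> insert t s \<Longrightarrow> pverts T \<subseteq> pverts t"
  by (auto simp: is_couple_def subforest_def subgraph_def)

lemma is_couple_point: "is_couple (\<lparr> pverts = {0}, parcs = {} \<rparr>, {})"
proof -
  have "connected (with_proj \<lparr> pverts = {0::nat}, parcs = {} \<rparr>)"
    by (auto simp: connected_def strongly_connected_def mk_symmetric_def reachable_def)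
  moreover have "pair_fin_digraph \<lparr> pverts = {0::nat}, parcs = {} \<rparr>"
    by unfold_locales auto
  ultimately show ?thesis
    by (auto simp: is_couple_def rooted_tree_def simply_connected_digraph_def in_degree_def
        in_arcs_def subforest_def rooted_forest_def)
qed

quotient_type couple = raw_couple / partial: couple_iso
proof (rule part_equivpI)
  have "couple_iso (\<lparr> pverts = {0}, parcs = {} \<rparr>, {}) (\<lparr> pverts = {0}, parcs = {} \<rparr>, {})"
    using is_couple_point by (auto simp: couple_iso_def intro!: exI[of _ id] map_digraph_id)
  then show "\<exists>x. couple_iso x x" by blast
next
  show "symp couple_iso"
  proof (rule sympI)
    fix x y assume "couple_iso x y"
    then obtain t s t' s' f where xy: "x = (t, s)" "y = (t', s')"
      and c: "is_couple (t, s)" "is_couple (t', s')"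
      and f: "inj_on f (pverts t)" "map_digraph f t = t'" "map_digraph f ` s = s'"
      by (auto simp: couple_iso_def)
    let ?g = "inv_into (pverts t) f"
    have inverse_iso: "map_digraph ?g (map_digraph f T) = T" if "T \<in> insert t s" for T
      unfolding map_digraph_comp using is_couple_verts[OF c(1) that] f(1)
      by (intro map_digraph_cong_id is_couple_wf[OF c(1) that]) (auto simp: inv_into_f_f)
    have "inj_on ?g (pverts t')"
      using f(2) by (auto simp: map_digraph_def intro: inj_on_inv_into)
    moreover have "map_digraph ?g t' = t"
      using inverse_iso f(2) by auto
    moreover have "map_digraph ?g ` s' = s"
      using inverse_iso f(3) by (force simp: image_comp)
    ultimately show "couple_iso y x"
      using c by (auto simp: xy couple_iso_def)
  qed
next
  show "transp couple_iso"
  proof (rule transpI)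
    fix x y z assume "couple_iso x y" "couple_iso y z"
    then obtain t s t' s' t'' s'' f g where e: "x = (t, s)" "y = (t', s')" "z = (t'', s'')"
      and c: "is_couple (t, s)" "is_couple (t'', s'')"
      and f: "inj_on f (pverts t)" "map_digraph f t = t'" "map_digraph f ` s = s'"
      and g: "inj_on g (pverts t')" "map_digraph g t' = t''" "map_digraph g ` s' = s''"
      by (auto simp: couple_iso_def)
    have "inj_on (g \<circ> f) (pverts t)"
      using f g(1) by (auto simp: map_digraph_def intro: comp_inj_on)
    moreover have "map_digraph (g \<circ> f) t = t''" "map_digraph (g \<circ> f) ` s = s''"
      unfolding map_digraph_comp[symmetric] using f g by auto
    ultimately show "couple_iso x z"
      using c by (auto simp: e couple_iso_def)
  qed
qed


section \<open>The algebra generated by couples and its structure maps\<close>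

text \<open>
  The symmetric algebra on the space spanned by the couples is the polynomial algebra in the
  couples. Its basis consists of the monomials, that is, the multisets of couples, and the
  multiset \<open>{#(t\<^sub>1, s\<^sub>1), \<dots>, (t\<^sub>n, s\<^sub>n)#}\<close> is the pair of forests
  \<open>(t\<^sub>1 \<dots> t\<^sub>n, s\<^sub>1 \<dots> s\<^sub>n)\<close>. The ring multiplication of
  \<^typ>\<open>'x multiset \<Rightarrow>\<^sub>0 'k::field\<close> is the bilinear extension of the sum of multisets.
\<close>

type_synonym 'k dtilde = "couple multiset \<Rightarrow>\<^sub>0 'k"

text \<open>
  The choice of representatives by \<^const>\<open>rep_couple\<close> is immaterial, since all the constructions
  below are invariant under isomorphism of couples.
\<close>

definition Gamma_couple :: "couple \<Rightarrow> (couple multiset \<times> couple multiset \<Rightarrow>\<^sub>0 'k::field)" where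
  "Gamma_couple c =
     (let (t, s) = rep_couple c in
      \<Sum>s' | covering_subforest s' s.
        tensor (basis {#abs_couple (t, s')#})
               (basis {#abs_couple (contract s' t, contract s' ` s)#}))"

text \<open>
  The product used on monomials is the one of the algebra \<open>D \<otimes> D\<close>, as the monoid structure on
  \<open>couple multiset \<times> couple multiset\<close> is componentwise.
\<close>

definition Gamma_coproduct :: "'k::field dtilde \<Rightarrow> (couple multiset \<times> couple multiset \<Rightarrow>\<^sub>0 'k)" where
  "Gamma_coproduct = lin_ext scale (\<lambda>M. \<Prod>c\<in>#M. Gamma_couple c)"

definition couple_edges :: "couple \<Rightarrow> nat" where
  "couple_edges c = (\<Sum>T\<in>snd (rep_couple c). card (parcs T))"

definition counit :: "'k::field dtilde \<Rightarrow> 'k" where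
  "counit = lin_ext (*) (\<lambda>M. \<Prod>c\<in>#M. if couple_edges c = 0 then 1 else 0)"

definition edge_grading :: "nat \<Rightarrow> 'k::field dtilde set" where
  "edge_grading n = {p. \<forall>M\<in>Poly_Mapping.keys p. (\<Sum>c\<in>#M. couple_edges c) = n}"

end

theory Submission
  imports Defs
begin

text \<open>
  The theorem has an algebraic and a combinatorial half.

  The algebra is a polynomial algebra and the coproduct, the counit and the degree are extended from
  single couples multiplicatively. Hence the two sides of coassociativity, and of each counit law, are
  morphisms of algebras, and two such morphisms agree as soon as they agree on generators
  (\<open>alg_hom_eq_on_generators\<close>). The grading is by the weight of monomials, which the coproduct preserves
  if it does so on generators. So everything reduces to identities for one couple
  (\<open>graded_bialgebra_of_generators\<close>).

  For the combinatorics, a rooted forest is a finite vertex set with an acyclic arc relation in which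
  each vertex has at most one parent, here called a branching (\<open>forest_of_verts_arcs\<close>). A covering
  subforest of a forest with arc relation \<open>F\<close> is then just a subset of \<open>F\<close>
  (\<open>covering_subforest_forest_of_iff\<close>), so that with \<open>s\<^sub>G\<close> for the covering subforest of \<open>s\<close> with
  arcs \<open>G\<close> the coproduct of \<open>(t, s)\<close> is the sum over all \<open>G \<subseteq> F\<close> of
  \<open>(t, s\<^sub>G) \<otimes> (t / s\<^sub>G, s / s\<^sub>G)\<close> (\<open>Gamma_couple_couple_of\<close>).

  Contraction sends each vertex to the root of its component. The head of an arc outside \<open>G\<close> is
  such a root, and no two arcs have the same head, so the arcs outside \<open>G\<close> stay distinct. So \<open>s / s\<^sub>G\<close> has \<open>card F - card G\<close> edges, its covering
  subforests correspond to the sets between \<open>G\<close> and \<open>F\<close> (\<open>bij_betw_contract_arcs\<close>), and contracting in two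
  stages is literally the same as contracting at once (\<open>contract_arcs_contract_arcs\<close>). Both iterated
  coproducts are therefore sums of the same terms over the pairs of nested subsets of \<open>F\<close>
  (\<open>Gamma_coassoc_couple\<close>). The counit singles out the terms with \<open>G = {}\<close> or \<open>G = F\<close>, and the edge
  numbers \<open>card G\<close> and \<open>card F - card G\<close> of the two factors add up to \<open>card F\<close>.
\<close>

section \<open>Linear extension on free vector spaces\<close>

lemma lookup_scale [simp]: "Poly_Mapping.lookup (scale c p) x = c * Poly_Mapping.lookup p x"
  by (simp add: scale_def map.rep_eq when_def)

lemma scale_conv_mult: "scale c (p :: 'x::monoid_add \<Rightarrow>\<^sub>0 'k::field) = Poly_Mapping.single 0 c * p"
  by (simp add: scale_def mult_map_scale_conv_mult)

lemma scale_mult_left: "scale c p * q = scale c (p * q :: 'x::monoid_add \<Rightarrow>\<^sub>0 'k::field)"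
  by (simp add: scale_conv_mult mult.assoc)

lemma scale_mult_right: "p * scale c q = scale c (p * q :: 'x::comm_monoid_add \<Rightarrow>\<^sub>0 'k::field)"
  by (simp add: scale_conv_mult mult.left_commute)

interpretation free_space: vector_space "scale :: 'k::field \<Rightarrow> ('x \<Rightarrow>\<^sub>0 'k) \<Rightarrow> _"
  by unfold_locales (auto intro!: poly_mapping_eqI simp: lookup_add algebra_simps)

interpretation ground_field: vector_space "(*) :: 'k::field \<Rightarrow> 'k \<Rightarrow> 'k"
  by unfold_locales (auto simp: algebra_simps)

lemma linear_scaleI:
  assumes "vector_space sc" "\<And>a b. f (a + b) = f a + f b" "\<And>c a. f (scale c a) = sc c (f a)"
  shows "Vector_Spaces.linear scale sc f"
  using assms free_space.vector_space_axioms
  by (simp add: Vector_Spaces.linear_def module_hom_def module_hom_axioms_def module_iff_vector_space)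

lemmas linear_add = module_hom.add[OF Vector_Spaces.linear.axioms(3)]
  and linear_smult = module_hom.scale[OF Vector_Spaces.linear.axioms(3)]
  and linear_setsum = module_hom.sum[OF Vector_Spaces.linear.axioms(3)]

lemma basis_expansion:
  "p = (\<Sum>x\<in>Poly_Mapping.keys p. scale (Poly_Mapping.lookup p x) (basis x))"
  by (rule poly_mapping_eqI)
    (auto simp: lookup_sum basis_def lookup_single when_def if_distrib sum.delta' in_keys_iff
      cong: if_cong)

lemma linear_eq_on_basis:
  assumes "Vector_Spaces.linear scale sc f" "Vector_Spaces.linear scale sc g"
    and "\<And>x. f (basis x) = g (basis x)"
  shows "f p = g p"
  by (subst (1 2) basis_expansion[of p]) (simp add: linear_setsum[OF assms(1)]
    linear_setsum[OF assms(2)] linear_smult[OF assms(1)] linear_smult[OF assms(2)] assms(3))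

context
  fixes sc :: "'k::field \<Rightarrow> 'v \<Rightarrow> 'v::ab_group_add"
  assumes vs: "vector_space sc"
begin

lemma lin_ext_superset:
  assumes "finite S" "Poly_Mapping.keys p \<subseteq> S"
  shows "lin_ext sc f p = (\<Sum>x\<in>S. sc (Poly_Mapping.lookup p x) (f x))"
proof -
  interpret vector_space sc by (fact vs)
  show ?thesis
    unfolding lin_ext_def using assms by (intro sum.mono_neutral_left) (auto simp: in_keys_iff)
qed

lemma linear_lin_ext: "Vector_Spaces.linear scale sc (lin_ext sc (f :: 'x \<Rightarrow> 'v))"
proof (rule linear_scaleI[OF vs])
  interpret vector_space sc by (fact vs)
  fix p q :: "'x \<Rightarrow>\<^sub>0 'k" and c
  let ?S = "Poly_Mapping.keys p \<union> Poly_Mapping.keys q"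
  have "Poly_Mapping.keys (p + q) \<subseteq> ?S" by (rule keys_add)
  then show "lin_ext sc f (p + q) = lin_ext sc f p + lin_ext sc f q"
    by (subst (1 2 3) lin_ext_superset[where S = ?S])
      (auto simp: lookup_add scale_left_distrib sum.distrib)
  have "Poly_Mapping.keys (scale c p) \<subseteq> Poly_Mapping.keys p" by (auto simp: in_keys_iff)
  then show "lin_ext sc f (scale c p) = sc c (lin_ext sc f p)"
    by (subst (1 2) lin_ext_superset[where S = "Poly_Mapping.keys p"])
      (auto simp: scale_sum_right)
qed

lemma lin_ext_basis [simp]: "lin_ext sc f (basis x) = f x"
proof -
  interpret vector_space sc by (fact vs)
  show ?thesis by (simp add: lin_ext_def basis_def)
qed

end

lemmas scale_linear_lin_ext = linear_lin_ext[OF free_space.vector_space_axioms]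
lemmas scale_lin_ext_basis [simp] = lin_ext_basis[OF free_space.vector_space_axioms]
lemmas field_lin_ext_basis [simp] = lin_ext_basis[OF ground_field.vector_space_axioms]

section \<open>Tensor products of monoid algebras\<close>

lemma basis_mult: "basis x * basis y = basis (x + y)"
  by (simp add: basis_def mult_single)

lemma basis_zero: "basis 0 = 1"
  by (simp add: basis_def)

lemma linear_mult_left: "Vector_Spaces.linear scale scale (\<lambda>a. a * b :: 'x::monoid_add \<Rightarrow>\<^sub>0 'k::field)"
  by (rule linear_scaleI) (auto simp: free_space.vector_space_axioms distrib_right scale_mult_left)

lemma linear_mult_right:
  "Vector_Spaces.linear scale scale (\<lambda>b. a * b :: 'x::comm_monoid_add \<Rightarrow>\<^sub>0 'k::field)"
  by (rule linear_scaleI) (auto simp: free_space.vector_space_axioms distrib_left scale_mult_right)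

text \<open>
  Both sides are bilinear, so they may be compared on basis elements, where the claim is the
  assumption on \<open>f\<close>.
\<close>

lemma lin_ext_mult:
  fixes f :: "'x::comm_monoid_add \<Rightarrow> 'v::comm_ring" and a b :: "'x \<Rightarrow>\<^sub>0 'k::field"
  assumes vs: "vector_space sc" and sc: "\<And>c v w. sc c v * w = sc c (v * w)"
    and f: "\<And>x y. f (x + y) = f x * f y"
  shows "lin_ext sc f (a * b) = lin_ext sc f a * lin_ext sc f b"
proof -
  note lin = linear_lin_ext[OF vs] and linb = lin_ext_basis[OF vs]
  have sc': "v * sc c w = sc c (v * w)" for c v w
    using sc[of c w v] by (simp add: mult.commute)
  have 1: "lin_ext sc f (basis x * b) = f x * lin_ext sc f b" for x
    by (rule linear_eq_on_basis[where sc = sc and p = b])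
      (auto intro!: linear_scaleI vs simp: distrib_left scale_mult_right linear_add[OF lin]
        linear_smult[OF lin] sc' basis_mult linb f)
  show ?thesis
    by (rule linear_eq_on_basis[where sc = sc and p = a])
      (auto intro!: linear_scaleI vs simp: distrib_right scale_mult_left linear_add[OF lin]
        linear_smult[OF lin] sc 1 linb)
qed

definition alg_hom ::
  "(('x::comm_monoid_add \<Rightarrow>\<^sub>0 'k::field) \<Rightarrow> ('y::comm_monoid_add \<Rightarrow>\<^sub>0 'k)) \<Rightarrow> bool" where
  "alg_hom f \<longleftrightarrow>
     Vector_Spaces.linear scale scale f \<and> f 1 = 1 \<and> (\<forall>a b. f (a * b) = f a * f b)"

lemma alg_homD:
  assumes "alg_hom f"
  shows "Vector_Spaces.linear scale scale f" "f 1 = 1" "f (a * b) = f a * f b"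
  using assms by (auto simp: alg_hom_def)

lemma alg_hom_lin_ext:
  assumes "f 0 = 1" "\<And>x y. f (x + y) = f x * f y"
  shows "alg_hom (lin_ext scale f)"
  unfolding alg_hom_def
proof (intro conjI allI)
  show "lin_ext scale f 1 = 1" using scale_lin_ext_basis[of f 0] assms(1) by (simp add: basis_zero)
qed (auto simp: scale_linear_lin_ext
     intro!: assms(2) lin_ext_mult[OF free_space.vector_space_axioms scale_mult_left])

lemma alg_hom_id: "alg_hom id"
  by (auto simp: alg_hom_def intro!: linear_scaleI free_space.vector_space_axioms)

lemma alg_hom_comp: "alg_hom f \<Longrightarrow> alg_hom g \<Longrightarrow> alg_hom (\<lambda>a. g (f a))"
  unfolding alg_hom_def using Vector_Spaces.linear_compose[of scale scale f scale g]
  by (simp add: o_def)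

text \<open>
  The monomial of a multiset is the product of its elements, so an algebra morphism on the polynomial
  algebra is determined by its values on the indeterminates. This reduces every identity between
  algebra morphisms to single generators.
\<close>

lemma alg_hom_eq_on_generators:
  fixes f g :: "('c multiset \<Rightarrow>\<^sub>0 'k::field) \<Rightarrow> ('y::comm_monoid_add \<Rightarrow>\<^sub>0 'k)"
  assumes "alg_hom f" "alg_hom g" "\<And>c. f (basis {#c#}) = g (basis {#c#})"
  shows "f p = g p"
proof (rule linear_eq_on_basis[where f = f and g = g and sc = scale])
  fix M :: "'c multiset"
  show "f (basis M) = g (basis M)"
  proof (induction M)
    case empty
    show ?case using assms(1,2)[THEN alg_homD(2)] by (simp flip: basis_zero)
  next
    case (add c M)
    have "basis (add_mset c M) = basis {#c#} * (basis M :: _ \<Rightarrow>\<^sub>0 'k)"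
      by (simp add: basis_mult)
    then show ?case
      using add assms(3) by (simp add: alg_homD(3)[OF assms(1)] alg_homD(3)[OF assms(2)])
  qed
qed (fact assms(1,2)[THEN alg_homD(1)])+

lemma tensor_basis [simp]: "tensor (basis x) (basis y) = basis (x, y)"
  by (simp add: tensor_def)

text \<open>
  Over monoid algebras, \<open>a \<otimes> b = (a \<otimes> 1)(1 \<otimes> b)\<close>. The two factors are images under algebra
  morphisms into a commutative algebra, which gives the product rule
  \<open>tensor_mult_tensor\<close> without expanding four sums.
\<close>

lemma tensor_conv_mult:
  fixes a :: "'x::comm_monoid_add \<Rightarrow>\<^sub>0 'k::field" and b :: "'y::comm_monoid_add \<Rightarrow>\<^sub>0 'k"
  shows "tensor a b = lin_ext scale (\<lambda>x. basis (x, 0)) a * lin_ext scale (\<lambda>y. basis (0, y)) b"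
proof -
  note lin = scale_linear_lin_ext
  \<comment> \<open>The name keeps \<open>*\<close> below from rewriting its own right-hand side, which is an instance
    of its left-hand side with \<open>x = 0\<close>.\<close>
  define R where "R = lin_ext scale (\<lambda>y. basis (0 :: 'x, y)) b"
  have *: "lin_ext scale (\<lambda>y. basis (x, y)) b = basis (x, 0) * R" for x :: 'x
    unfolding R_def
    by (rule linear_eq_on_basis[where sc = scale and p = b])
      (auto intro!: linear_scaleI free_space.vector_space_axioms
        simp: linear_add[OF lin] linear_smult[OF lin] distrib_left scale_mult_right basis_mult)
  show ?thesis unfolding tensor_def R_def[symmetric] *
    by (rule linear_eq_on_basis[where sc = scale and p = a])
      (auto intro!: linear_scaleI free_space.vector_space_axioms
        simp: linear_add[OF lin] linear_smult[OF lin] distrib_right scale_mult_left)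
qed

lemma tensor_mult_tensor:
  fixes a c :: "'x::comm_monoid_add \<Rightarrow>\<^sub>0 'k::field" and b d :: "'y::comm_monoid_add \<Rightarrow>\<^sub>0 'k"
  shows "tensor (a * c) (b * d) = tensor a b * tensor c d"
proof -
  have "lin_ext scale (\<lambda>x. basis (x, 0 :: 'y)) (a * c) =
      lin_ext scale (\<lambda>x. basis (x, 0)) a * lin_ext scale (\<lambda>x. basis (x, 0)) c"
    and "lin_ext scale (\<lambda>y. basis (0 :: 'x, y)) (b * d) =
      lin_ext scale (\<lambda>y. basis (0, y)) b * lin_ext scale (\<lambda>y. basis (0, y)) d"
    by (simp_all add: lin_ext_mult[OF free_space.vector_space_axioms scale_mult_left] basis_mult)
  then show ?thesis by (simp add: tensor_conv_mult mult_ac)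
qed

lemma tensor_one: "tensor 1 1 = 1"
  by (simp add: zero_prod_def flip: basis_zero)

lemma tensor_mult_mult:
  fixes P Q :: "'x::comm_monoid_add \<times> 'x \<Rightarrow>\<^sub>0 'k::field"
  shows "tensor_mult (*) P Q = P * Q"
proof -
  note lin = scale_linear_lin_ext
  have 1: "lin_ext scale (\<lambda>(c, d). tensor (basis (fst x) * basis c) (basis (snd x) * basis d)) Q
      = basis x * Q" for x :: "'x \<times> 'x"
    by (rule linear_eq_on_basis[where sc = scale and p = Q])
      (auto intro!: lin linear_mult_right simp: basis_mult plus_prod_def)
  have *: "tensor_mult (*) P Q = lin_ext scale (\<lambda>x. basis x * Q) P"
    unfolding tensor_mult_def 1[symmetric] by (simp add: case_prod_unfold)
  show ?thesis unfolding *
    by (rule linear_eq_on_basis[where sc = scale and p = P]) (auto intro!: lin linear_mult_left)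
qed

lemma alg_hom_tensor_map:
  assumes "alg_hom f" "alg_hom g"
  shows "alg_hom (tensor_map f g)"
  unfolding tensor_map_def
  by (rule alg_hom_lin_ext) (auto simp: zero_prod_def basis_zero tensor_one alg_homD[OF assms(1)]
    alg_homD[OF assms(2)] tensor_mult_tensor basis_mult[symmetric] split: prod.splits)

lemma alg_hom_tensor_assoc: "alg_hom tensor_assoc"
  unfolding tensor_assoc_def
  by (rule alg_hom_lin_ext) (auto simp: zero_prod_def basis_mult split: prod.splits 
   simp flip: basis_zero)

lemma alg_hom_form:
  assumes "e 1 = 1" "\<And>a b. e (a * b) = e a * e b"
  shows "alg_hom (form_left e)" "alg_hom (form_right e)"
  unfolding form_left_def form_right_def
  by (rule alg_hom_lin_ext; auto simp: zero_prod_def basis_zero assms basis_mult[symmetric]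
      scale_mult_left scale_mult_right mult.commute)+

section \<open>Bialgebra structures on symmetric algebras\<close>

lemma keys_basis [simp]: "Poly_Mapping.keys (basis x) = {x}"
  by (simp add: basis_def)

text \<open>
  The component of degree \<open>n\<close> of \<open>a\<close> can only be the restriction of \<open>a\<close> to the basis elements of
  weight \<open>n\<close>: at a basis element \<open>x\<close>, all the components other than the one of degree \<open>w x\<close> vanish.
\<close>

lemma direct_sum_by_degree:
  fixes w :: "'x \<Rightarrow> nat" and a :: "'x \<Rightarrow>\<^sub>0 'k::field"
  defines "G \<equiv> \<lambda>n. {p :: 'x \<Rightarrow>\<^sub>0 'k. \<forall>x\<in>Poly_Mapping.keys p. w x = n}"
  shows "\<exists>!q. (\<forall>n. q n \<in> G n) \<and> finite {n. q n \<noteq> 0} \<and> a = (\<Sum>n | q n \<noteq> 0. q n)"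
proof -
  have component: "Poly_Mapping.lookup (q n) x = (if w x = n then Poly_Mapping.lookup a x else 0)"
    if q: "\<forall>n. q n \<in> G n" "finite {n. q n \<noteq> 0}" "a = (\<Sum>n | q n \<noteq> 0. q n)" for q n x
  proof -
    have zero: "Poly_Mapping.lookup (q m) x = 0" if "m \<noteq> w x" for m
    proof -
      have "x \<notin> Poly_Mapping.keys (q m)" using q(1) that by (auto simp: G_def)
      then show ?thesis by (simp add: in_keys_iff)
    qed
    have "Poly_Mapping.lookup a x = (\<Sum>m | q m \<noteq> 0. Poly_Mapping.lookup (q m) x)"
      using q(3) by (simp add: lookup_sum)
    also have "\<dots> = (\<Sum>m | q m \<noteq> 0. if m = w x then Poly_Mapping.lookup (q (w x)) x else 0)"
      by (rule sum.cong) (auto simp: zero)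
    also have "\<dots> = Poly_Mapping.lookup (q (w x)) x"
      using q(2) by simp
    finally show ?thesis using zero by auto
  qed
  define q where "q n = (\<Sum>x\<in>{x \<in> Poly_Mapping.keys a. w x = n}. scale (Poly_Mapping.lookup a x) (basis x))" for n
  have lookup_q: "Poly_Mapping.lookup (q n) x = (if w x = n then Poly_Mapping.lookup a x else 0)" for n x
    by (auto simp: q_def lookup_sum basis_def lookup_single when_def if_distrib sum.delta' in_keys_iff
      cong: if_cong)
  have supp: "{n. q n \<noteq> 0} \<subseteq> w ` Poly_Mapping.keys a"
  proof
    fix n assume "n \<in> {n. q n \<noteq> 0}"
    then obtain x where "Poly_Mapping.lookup (q n) x \<noteq> 0"
      by (metis (mono_tags) lookup_zero mem_Collect_eq poly_mapping_eqI)
    then show "n \<in> w ` Poly_Mapping.keys a" 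
      by (auto simp: lookup_q in_keys_iff split: if_splits)
  qed
  then have fin: "finite {n. q n \<noteq> 0}" by (rule finite_subset) simp
  show ?thesis
  proof (rule ex1I[of _ q], intro conjI)
    show "\<forall>n. q n \<in> G n" by (auto simp: G_def in_keys_iff lookup_q split: if_splits)
    show "finite {n. q n \<noteq> 0}" by (fact fin)
    show "a = (\<Sum>n | q n \<noteq> 0. q n)"
    proof (rule poly_mapping_eqI)
      fix x
      have "Poly_Mapping.lookup (\<Sum>n | q n \<noteq> 0. q n) x =
          (\<Sum>n | q n \<noteq> 0. if n = w x then Poly_Mapping.lookup a x else 0)"
        unfolding lookup_sum by (rule sum.cong) (auto simp: lookup_q)
      also have "\<dots> = Poly_Mapping.lookup a x"
        using fin lookup_q[of "w x" x] by auto
      finally show "Poly_Mapping.lookup a x = Poly_Mapping.lookup (\<Sum>n | q n \<noteq> 0. q n) x" ..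
    qed
  next
    fix q' assume "(\<forall>n. q' n \<in> G n) \<and> finite {n. q' n \<noteq> 0} \<and> a = (\<Sum>n | q' n \<noteq> 0. q' n)"
    then show "q' = q" by (auto intro!: ext poly_mapping_eqI simp: component lookup_q)
  qed
qed

text \<open>
  A coproduct \<open>h\<close>, a counit \<open>e\<close> and a degree \<open>d\<close> are prescribed on the indeterminates of a polynomial
  algebra and extended multiplicatively (for the degree: additively). The coalgebra axioms, which
  are assumed on indeterminates only, then hold throughout.
\<close>

locale coproduct_on_generators =
  fixes h :: "'c \<Rightarrow> ('c multiset \<times> 'c multiset \<Rightarrow>\<^sub>0 'k::field)"
    and e :: "'c \<Rightarrow> 'k"
    and d :: "'c \<Rightarrow> nat"
  fixes coprod counit_ext wt
  defines "coprod \<equiv> lin_ext scale (\<lambda>M. \<Prod>c\<in>#M. h c)"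
    and "counit_ext \<equiv> lin_ext (*) (\<lambda>M. \<Prod>c\<in>#M. e c)"
    and "wt \<equiv> \<lambda>M. \<Sum>c\<in>#M. d c"
  assumes coassoc_generator:
      "tensor_assoc (tensor_map coprod id (h c)) = tensor_map id coprod (h c)"
    and counit_left_generator: "form_left counit_ext (h c) = basis {#c#}"
    and counit_right_generator: "form_right counit_ext (h c) = basis {#c#}"
    and degree_generator: "(M, N) \<in> Poly_Mapping.keys (h c) \<Longrightarrow> wt M + wt N = d c"
    and counit_degree_generator: "d c > 0 \<Longrightarrow> e c = 0"
begin

definition degree_space :: "nat \<Rightarrow> ('c multiset \<Rightarrow>\<^sub>0 'k) set" where
  "degree_space n = {p. \<forall>M\<in>Poly_Mapping.keys p. wt M = n}"

lemma wt_add [simp]: "wt (M + N) = wt M + wt N"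
  and wt_add_mset [simp]: "wt (add_mset c M) = d c + wt M"
  and wt_empty [simp]: "wt {#} = 0"
  by (simp_all add: wt_def)

lemma coprod_basis: "coprod (basis M) = (\<Prod>c\<in>#M. h c)"
  by (simp add: coprod_def)

lemma alg_hom_coprod: "alg_hom coprod"
  unfolding coprod_def by (rule alg_hom_lin_ext) auto

lemma counit_linear: "Vector_Spaces.linear scale (*) counit_ext"
  unfolding counit_ext_def by (rule linear_lin_ext) (rule ground_field.vector_space_axioms)

lemma counit_basis: "counit_ext (basis M) = (\<Prod>c\<in>#M. e c)"
  by (simp add: counit_ext_def)

lemma counit_one: "counit_ext 1 = 1"
  unfolding basis_zero[symmetric] by (simp add: counit_basis)

lemma counit_mult: "counit_ext (a * b) = counit_ext a * counit_ext b"
proof -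
  have "c * v * w = c * (v * w)" for c v w :: 'k by (rule mult.assoc)
  then show ?thesis
    unfolding counit_ext_def by (simp add: lin_ext_mult[OF ground_field.vector_space_axioms])
qed

text \<open>
  The coproduct preserves the total degree: this holds on generators and is stable under products,
  because the degree of a product of monomials is the sum of the degrees.
\<close>

lemma keys_coprod_basis:
  "(N, N') \<in> Poly_Mapping.keys (coprod (basis M)) \<Longrightarrow> wt N + wt N' = wt M"
proof (induction M arbitrary: N N')
  case empty
  then show ?case by (simp add: coprod_basis zero_prod_def)
next
  case (add c M)
  have "coprod (basis (add_mset c M)) = h c * coprod (basis M)"
    by (simp add: coprod_basis)
  then obtain x y where xy: "(N, N') = x + y" "x \<in> Poly_Mapping.keys (h c)"
    "y \<in> Poly_Mapping.keys (coprod (basis M))"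
    using add.prems keys_mult[of "h c" "coprod (basis M)"] by auto
  obtain A A' B B' where split: "x = (A, A')" "y = (B, B')" by (metis surj_pair)
  have "wt A + wt A' = d c" using xy(2) degree_generator by (simp add: split)
  moreover have "wt B + wt B' = wt M" using xy(3) add.IH by (simp add: split)
  ultimately show ?case using xy(1) by (simp add: split)
qed

lemma keys_coprod:
  assumes "a \<in> degree_space n" "(N, N') \<in> Poly_Mapping.keys (coprod a)"
  shows "wt N + wt N' = n"
proof -
  have "coprod a = (\<Sum>M\<in>Poly_Mapping.keys a. scale (Poly_Mapping.lookup a M) (coprod (basis M)))"
    by (simp add: coprod_basis) (simp add: coprod_def lin_ext_def)
  then obtain M where "M \<in> Poly_Mapping.keys a"
    "(N, N') \<in> Poly_Mapping.keys (scale (Poly_Mapping.lookup a M) (coprod (basis M)))"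
    using assms(2) keys_sum by fastforce
  then show ?thesis
    using assms(1) keys_coprod_basis[of N N' M] by (auto simp: degree_space_def in_keys_iff)
qed

text \<open>
  Multiplicativity of the coproduct and of the counit is built into their definition. It makes both
  sides of coassociativity and of the counit laws algebra morphisms, so that \<open>alg_hom_eq_on_generators\<close>
  leaves exactly the assumptions on generators.
\<close>

theorem graded_bialgebra_of_generators:
  "graded_bialgebra (*) (basis {#}) coprod counit_ext degree_space"
proof -
  have unit: "basis {#} = (1 :: 'c multiset \<Rightarrow>\<^sub>0 'k)" by (simp flip: basis_zero)
  note forms = alg_hom_form[of counit_ext, OF counit_one counit_mult]
  have coprod_single: "coprod (basis {#c#}) = h c" for c by (simp add: coprod_basis)
  show ?thesis
  proof (unfold unit, intro graded_bialgebra.intro bialgebra.intro unital_algebra.intro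
      counital_coalgebra.intro bialgebra_axioms.intro graded_bialgebra_axioms.intro)
    fix a b :: "'c multiset \<Rightarrow>\<^sub>0 'k" and i j n :: nat
    show "Vector_Spaces.linear scale scale ((*) a)" by (rule linear_mult_right)
    show "Vector_Spaces.linear scale scale (\<lambda>a. a * b)" by (rule linear_mult_left)
    show "Vector_Spaces.linear scale scale coprod" by (rule alg_homD[OF alg_hom_coprod])
    show "Vector_Spaces.linear scale (*) counit_ext" by (rule counit_linear)
    note hom_left = alg_hom_tensor_map[OF alg_hom_coprod alg_hom_id]
      and hom_right = alg_hom_tensor_map[OF alg_hom_id alg_hom_coprod]
    show "tensor_assoc (tensor_map coprod id (coprod a)) = tensor_map id coprod (coprod a)"
      by (rule alg_hom_eq_on_generators[OF
            alg_hom_comp[OF alg_hom_comp[OF alg_hom_coprod hom_left] alg_hom_tensor_assoc]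
            alg_hom_comp[OF alg_hom_coprod hom_right]])
        (simp add: coprod_single coassoc_generator)
    show "form_left counit_ext (coprod a) = a"
      using alg_hom_eq_on_generators[OF alg_hom_comp[OF alg_hom_coprod forms(1)] alg_hom_id]
      by (simp add: coprod_single counit_left_generator)
    show "form_right counit_ext (coprod a) = a"
      using alg_hom_eq_on_generators[OF alg_hom_comp[OF alg_hom_coprod forms(2)] alg_hom_id]
      by (simp add: coprod_single counit_right_generator)
    show "coprod 1 = tensor 1 1" by (simp add: alg_homD(2)[OF alg_hom_coprod] tensor_one)
    show "coprod (a * b) = tensor_mult (*) (coprod a) (coprod b)"
      by (simp add: alg_homD(3)[OF alg_hom_coprod] tensor_mult_mult)
    show "counit_ext 1 = 1" by (rule counit_one)
    show "counit_ext (a * b) = counit_ext a * counit_ext b" by (rule counit_mult)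
    show "free_space.subspace (degree_space n)"
      unfolding free_space.subspace_def
    proof (intro conjI ballI allI)
      show "0 \<in> degree_space n" by (simp add: degree_space_def)
    next
      fix p q assume "p \<in> degree_space n" "q \<in> degree_space n"
      then have "wt M = n" if "M \<in> Poly_Mapping.keys p \<union> Poly_Mapping.keys q" for M
        using that unfolding degree_space_def by blast
      then show "p + q \<in> degree_space n"
        using keys_add[of p q] unfolding degree_space_def by blast
    next
      fix c p assume "p \<in> degree_space n"
      moreover have "Poly_Mapping.keys (scale c p) \<subseteq> Poly_Mapping.keys p"
        by (auto simp: in_keys_iff)
      ultimately show "scale c p \<in> degree_space n"
        unfolding degree_space_def by blast
    qed
    show "\<exists>!q. (\<forall>n. q n \<in> degree_space n) \<and> finite {n. q n \<noteq> 0} \<and> a = (\<Sum>n | q n \<noteq> 0. q n)"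
      unfolding degree_space_def by (rule direct_sum_by_degree)
    show "1 \<in> degree_space 0" by (simp add: degree_space_def)
    show "a * b \<in> degree_space (i + j)" if "a \<in> degree_space i" "b \<in> degree_space j"
      unfolding degree_space_def
    proof (intro CollectI ballI)
      fix M assume "M \<in> Poly_Mapping.keys (a * b)"
      then obtain A B where "M = A + B" "A \<in> Poly_Mapping.keys a" "B \<in> Poly_Mapping.keys b"
        using keys_mult[of a b] by blast
      then show "wt M = i + j" using that by (simp add: degree_space_def)
    qed
    show "coprod a \<in> free_space.span
        (\<Union>i\<le>n. {tensor b c |b c. b \<in> degree_space i \<and> c \<in> degree_space (n - i)})"
      if "a \<in> degree_space n"
    proof -
      have "basis x \<in>
          (\<Union>i\<le>n. {tensor b c |b c. b \<in> degree_space i \<and> c \<in> degree_space (n - i)})"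
        if "x \<in> Poly_Mapping.keys (coprod a)" for x
      proof -
        obtain N N' where x: "x = (N, N')" by (cases x)
        have "wt N + wt N' = n" using keys_coprod[OF \<open>a \<in> degree_space n\<close>] that x by simp
        then have "wt N \<le> n" "basis N \<in> degree_space (wt N)" "basis N' \<in> degree_space (n - wt N)"
          by (auto simp: degree_space_def)
        then show ?thesis unfolding x tensor_basis[symmetric] by blast
      qed
      then show ?thesis
        by (subst basis_expansion[of "coprod a"])
          (rule free_space.span_sum, rule free_space.span_scale, rule free_space.span_base)
    qed
    show "counit_ext a = 0" if "a \<in> degree_space n" "0 < n"
    proof -
      have "(\<Prod>c\<in>#M. e c) = 0" if "M \<in> Poly_Mapping.keys a" for M
      proof -
        have "wt M > 0" using that \<open>a \<in> degree_space n\<close> \<open>0 < n\<close> by (auto simp: degree_space_def)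
        then have "\<exists>c\<in>#M. d c > 0" by (induction M) auto
        then obtain c where "c \<in># M" "e c = 0" using counit_degree_generator by blast
        then have "0 \<in># image_mset e M" by force
        then show ?thesis by (simp only: prod_mset_zero_iff)
      qed
      then show ?thesis
        unfolding counit_ext_def lin_ext_def by (intro sum.neutral ballI) (simp only: mult_zero_right)
    qed
    show "a * b * c = a * (b * c)" for c by (rule mult.assoc)
    show "1 * a = a" "a * 1 = a" by simp_all
  qed
qed

end

section \<open>Branchings\<close>

text \<open>
  A finite relation in which each vertex has at most one parent and no vertex is its own ancestor is the
  arc relation of a rooted forest; vertices outside its field are trees without arcs. As every part
  of a branching is a branching, subforests and contractions become operations on plain relations.
\<close>

definition branching :: "'a rel \<Rightarrow> bool" where
  "branching F \<longleftrightarrow> finite F \<and> single_valued (F\<inverse>) \<and> acyclic F"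

text \<open>
  This is the root of the component of \<open>v\<close>. It is \<open>v\<close> itself when \<open>v\<close> lies outside the field of \<open>F\<close>.
\<close>

definition apex :: "'a rel \<Rightarrow> 'a \<Rightarrow> 'a" where
  "apex F v = (THE r. (r, v) \<in> F\<^sup>* \<and> r \<notin> Range F)"

lemma branching_subset: "branching F \<Longrightarrow> F' \<subseteq> F \<Longrightarrow> branching F'"
  by (auto simp: branching_def single_valued_def intro: finite_subset acyclic_subset)

lemma branching_parent_unique: "branching F \<Longrightarrow> (u, v) \<in> F \<Longrightarrow> (u', v) \<in> F \<Longrightarrow> u = u'"
  by (auto simp: branching_def single_valued_def)

lemma rtrancl_root: "(u, r) \<in> F\<^sup>* \<Longrightarrow> r \<notin> Range F \<Longrightarrow> u = r"
  by (auto elim: rtranclE)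

text \<open>
  Climbing from \<open>v\<close> towards the parents is deterministic, so of two ancestors of \<open>v\<close> one lies above
  the other, and a vertex without parent is only below itself.
\<close>

lemma apex_eqI:
  assumes "branching F" "(r, v) \<in> F\<^sup>*" "r \<notin> Range F"
  shows "apex F v = r"
  unfolding apex_def
proof (rule the_equality)
  fix r' assume r': "(r', v) \<in> F\<^sup>* \<and> r' \<notin> Range F"
  have "(r, r') \<in> (F\<inverse>)\<^sup>* \<or> (r', r) \<in> (F\<inverse>)\<^sup>*"
    using assms r' by (intro single_valued_confluent[of "F\<inverse>" v])
      (auto simp: branching_def rtrancl_converse)
  then show "r' = r" using assms(3) r' by (auto simp: rtrancl_converse dest: rtrancl_root)
qed (use assms in auto)

text \<open>
  The parent relation of a finite acyclic relation is well-founded, so climbing ends.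
\<close>

lemma apex_reaches_root:
  assumes "branching F"
  shows "(apex F v, v) \<in> F\<^sup>* \<and> apex F v \<notin> Range F"
proof -
  have "wf F" using assms by (auto simp: branching_def finite_acyclic_wf)
  then have "\<exists>r. (r, v) \<in> F\<^sup>* \<and> r \<notin> Range F"
  proof (induction v rule: wf_induct_rule)
    case (less v)
    show ?case
    proof (cases "v \<in> Range F")
      case True
      then obtain u where "(u, v) \<in> F" by blast
      then show ?thesis using less[of u] by (blast intro: rtrancl_into_rtrancl)
    qed blast
  qed
  then show ?thesis using apex_eqI[OF assms] by auto
qed

lemmas apex_reaches = apex_reaches_root[THEN conjunct1]
  and apex_notin_Range = apex_reaches_root[THEN conjunct2]

lemma apex_root [simp]: "branching F \<Longrightarrow> v \<notin> Range F \<Longrightarrow> apex F v = v"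
  by (rule apex_eqI) auto

lemma apex_rtrancl: "branching F \<Longrightarrow> (u, v) \<in> F\<^sup>* \<Longrightarrow> apex F u = apex F v"
  by (rule sym, rule apex_eqI) (auto simp: apex_notin_Range intro: rtrancl_trans[OF apex_reaches])

lemma apex_arc: "branching F \<Longrightarrow> (u, v) \<in> F \<Longrightarrow> apex F u = apex F v"
  by (auto intro: apex_rtrancl)

lemma apex_in:
  assumes "branching F" "F \<subseteq> W \<times> W" "v \<in> W"
  shows "apex F v \<in> W"
  using apex_reaches[OF assms(1), of v] assms(2,3) by (auto elim: converse_rtranclE)

lemma apex_apex_subset: "branching F \<Longrightarrow> F' \<subseteq> F \<Longrightarrow> apex F (apex F' v) = apex F v"
  using apex_reaches[OF branching_subset, of F F' v] rtrancl_mono[of F' F] by (auto intro: apex_rtrancl)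

section \<open>Contraction of a branching\<close>

definition contract_arcs :: "'a rel \<Rightarrow> 'a rel \<Rightarrow> 'a rel" where
  "contract_arcs F A = map_prod (apex F) (apex F) ` (A - F)"

lemma contract_arcs_mono: "A \<subseteq> B \<Longrightarrow> contract_arcs F A \<subseteq> contract_arcs F B"
  by (auto simp: contract_arcs_def)

lemma rtrancl_contract_arcs:
  assumes "branching F" "(u, v) \<in> A\<^sup>*"
  shows "(apex F u, apex F v) \<in> (contract_arcs F A)\<^sup>*"
  using assms(2)
proof induction
  case (step y z)
  then show ?case
  proof (cases "(y, z) \<in> F")
    case False
    then have "(apex F y, apex F z) \<in> contract_arcs F A"
      using step by (force simp: contract_arcs_def)
    then show ?thesis using step by simp
  qed (use step apex_arc[OF assms(1), of y z] in simp)
qed simp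

context
  fixes F A :: "'a rel"
  assumes A: "branching A" and FA: "F \<subseteq> A"
begin

text \<open>
  The head of an arc outside \<open>F\<close> is the root of its \<open>F\<close>-component, because the only arc of \<open>A\<close> into
  it is not in \<open>F\<close>. Contraction therefore moves only the tails of the surviving arcs. As their heads are
  distinct, no two of them are merged.
\<close>

lemma apex_surviving_head: "(u, v) \<in> A - F \<Longrightarrow> apex F v = v"
  using branching_parent_unique[OF A] FA by (intro apex_root branching_subset[OF A FA]) blast

lemma contract_arcs_iff: "(x, v) \<in> contract_arcs F A \<longleftrightarrow> (\<exists>u. (u, v) \<in> A - F \<and> x = apex F u)"
proof
  assume "(x, v) \<in> contract_arcs F A"
  then obtain u w where "(u, w) \<in> A - F" "x = apex F u" "v = apex F w"
    by (auto simp: contract_arcs_def)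
  then show "\<exists>u. (u, v) \<in> A - F \<and> x = apex F u" using apex_surviving_head by auto
next
  assume "\<exists>u. (u, v) \<in> A - F \<and> x = apex F u"
  then obtain u where u: "(u, v) \<in> A - F" "x = apex F u" by blast
  then have "(x, v) = map_prod (apex F) (apex F) (u, v)" using apex_surviving_head by auto
  then show "(x, v) \<in> contract_arcs F A" using u unfolding contract_arcs_def by blast
qed

lemma inj_on_contract_arcs: "inj_on (map_prod (apex F) (apex F)) (A - F)"
proof (rule inj_onI, clarify, rule conjI)
  fix u v u' v'
  assume *: "map_prod (apex F) (apex F) (u, v) = map_prod (apex F) (apex F) (u', v')"
    "(u, v) \<in> A" "(u, v) \<notin> F" "(u', v') \<in> A" "(u', v') \<notin> F"
  then show "v = v'" using apex_surviving_head[of u v] apex_surviving_head[of u' v'] by auto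
  then show "u = u'" using * branching_parent_unique[OF A] by blast
qed

lemma Range_contract_arcs: "Range (contract_arcs F A) \<subseteq> Range A"
  by (auto simp: contract_arcs_iff)

text \<open>
  Each arc of the contracted relation stands for a path of \<open>A\<close>: first inside an \<open>F\<close>-component from
  its root, then along a surviving arc. So a cycle after the contraction would be one before.
\<close>

lemma branching_contract_arcs: "branching (contract_arcs F A)"
  unfolding branching_def
proof (intro conjI)
  show "finite (contract_arcs F A)" using A by (simp add: contract_arcs_def branching_def)
  show "single_valued ((contract_arcs F A)\<inverse>)"
    using branching_parent_unique[OF A] by (auto simp: single_valued_def contract_arcs_iff)
  have step: "contract_arcs F A \<subseteq> A\<^sup>+"
  proof
    fix e assume "e \<in> contract_arcs F A"
    then obtain u v where "e = (apex F u, v)" "(u, v) \<in> A" by (cases e) (auto simp: contract_arcs_iff)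
    moreover have "(apex F u, u) \<in> A\<^sup>*"
      using apex_reaches[OF branching_subset[OF A FA]] rtrancl_mono[OF FA] by blast
    ultimately show "e \<in> A\<^sup>+" by auto
  qed
  have "(x, y) \<in> A\<^sup>+" if "(x, y) \<in> (contract_arcs F A)\<^sup>+" for x y
    using that by induction (use step in \<open>auto intro: trancl_trans\<close>)
  then show "acyclic (contract_arcs F A)" using A by (auto simp: acyclic_def branching_def)
qed

lemma card_contract_arcs: "card (contract_arcs F A) = card A - card F"
  using A FA by (simp add: contract_arcs_def card_image[OF inj_on_contract_arcs] card_Diff_subset
    branching_def finite_subset)

end

text \<open>
  The root of a \<open>G\<close>-component is also the root of its own \<open>F\<close>-component, so it is still there after
  \<open>F\<close> is contracted. Since the representative of a contracted component is its root, contracting in two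
  stages gives the same vertices as contracting at once, and not only isomorphic ones.
\<close>

lemma apex_contract_arcs:
  assumes "branching G" "F \<subseteq> G"
  shows "apex (contract_arcs F G) (apex F v) = apex G v"
proof (rule apex_eqI)
  note F = branching_subset[OF assms]
  show "branching (contract_arcs F G)" by (rule branching_contract_arcs[OF assms])
  have "apex F (apex G v) = apex G v"
    using apex_notin_Range[OF assms(1), of v] assms(2) by (intro apex_root F) blast
  then show "(apex G v, apex F v) \<in> (contract_arcs F G)\<^sup>*"
    using rtrancl_contract_arcs[OF F apex_reaches[OF assms(1)], of v] by simp
  show "apex G v \<notin> Range (contract_arcs F G)"
    using Range_contract_arcs[OF assms] apex_notin_Range[OF assms(1)] by blast
qed

text \<open>
  This is \<open>(A / F) / (G / F) = A / G\<close>. Injectivity on the surviving arcs turns the difference of the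
  images into the image of \<open>A - G\<close>.
\<close>

lemma contract_arcs_contract_arcs:
  assumes "branching A" "F \<subseteq> G" "G \<subseteq> A"
  shows "contract_arcs (contract_arcs F G) (contract_arcs F A) = contract_arcs G A"
proof -
  note G = branching_subset[OF assms(1,3)]
  have FA: "F \<subseteq> A" using assms by blast
  have "contract_arcs F A - contract_arcs F G = map_prod (apex F) (apex F) ` (A - F - (G - F))"
    unfolding contract_arcs_def
    by (rule inj_on_image_set_diff[OF inj_on_contract_arcs[OF assms(1) FA], symmetric])
      (use assms in auto)
  also have "A - F - (G - F) = A - G" using assms by blast
  finally show ?thesis
    by (subst (1 3) contract_arcs_def) (auto simp: image_image map_prod_def split_beta apex_contract_arcs[OF G assms(2)])
qed

text \<open>
  This is the correspondence between the relations \<open>G\<close> with \<open>F \<subseteq> G \<subseteq> A\<close> and the subrelations of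
  \<open>A / F\<close> on which coassociativity rests.
\<close>

lemma bij_betw_contract_arcs:
  assumes "branching A" "F \<subseteq> A"
  shows "bij_betw (contract_arcs F) {G. F \<subseteq> G \<and> G \<subseteq> A} (Pow (contract_arcs F A))"
proof -
  have "bij_betw (\<lambda>G. G - F) {G. F \<subseteq> G \<and> G \<subseteq> A} (Pow (A - F))"
    by (rule bij_betw_byWitness[where f' = "\<lambda>H. H \<union> F"]) (use assms in auto)
  moreover have "bij_betw ((`) (map_prod (apex F) (apex F))) (Pow (A - F)) (Pow (contract_arcs F A))"
    unfolding contract_arcs_def
    by (rule bij_betw_Pow) (rule inj_on_imp_bij_betw[OF inj_on_contract_arcs[OF assms]])
  ultimately show ?thesis
    by (rule bij_betw_trans[THEN bij_betw_cong[THEN iffD1, rotated]]) (simp add: contract_arcs_def)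
qed

section \<open>Transport of a branching along an injection\<close>

lemma branching_map:
  assumes "branching F" "F \<subseteq> V \<times> V" "inj_on f V"
  shows "branching (map_prod f f ` F)"
  unfolding branching_def
proof (intro conjI)
  show "finite (map_prod f f ` F)" using assms(1) by (simp add: branching_def)
  show "single_valued ((map_prod f f ` F)\<inverse>)"
  proof (rule single_valuedI)
    fix y x x' assume "(y, x) \<in> (map_prod f f ` F)\<inverse>" "(y, x') \<in> (map_prod f f ` F)\<inverse>"
    then obtain u v u' v' where uv: "(u, v) \<in> F" "x = f u" "y = f v" "(u', v') \<in> F" "x' = f u'" "y = f v'"
      by auto
    then have "v = v'" using assms(2,3) by (auto dest: inj_onD)
    then show "x = x'" using uv branching_parent_unique[OF assms(1)] by blast
  qed
  have inverse: "(inv_into V f x, inv_into V f y) \<in> F\<^sup>+" if "(x, y) \<in> (map_prod f f ` F)\<^sup>+" for x y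
    using that
  proof induction
    case (base y)
    then show ?case using assms(2,3) by (auto simp: inv_into_f_f)
  next
    case (step y z)
    then have "(inv_into V f y, inv_into V f z) \<in> F" using assms(2,3) by (auto simp: inv_into_f_f)
    then show ?case using step by auto
  qed
  show "acyclic (map_prod f f ` F)"
    using inverse assms(1) by (auto simp: acyclic_def branching_def)
qed

text \<open>
  Only injectivity on the vertices is available, so the root of the image is identified through the
  characterisation \<open>apex_eqI\<close> and not by transporting the definition.
\<close>

lemma apex_map:
  assumes "branching F" "F \<subseteq> V \<times> V" "inj_on f V" "v \<in> V"
  shows "apex (map_prod f f ` F) (f v) = f (apex F v)"
proof (rule apex_eqI)
  show "branching (map_prod f f ` F)" by (rule branching_map[OF assms(1-3)])
  have "(f u, f w) \<in> (map_prod f f ` F)\<^sup>*" if "(u, w) \<in> F\<^sup>*" for u w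
    using that by induction (force intro: rtrancl_into_rtrancl)+
  then show "(f (apex F v), f v) \<in> (map_prod f f ` F)\<^sup>*" using apex_reaches[OF assms(1)] by blast
  show "f (apex F v) \<notin> Range (map_prod f f ` F)"
  proof
    assume "f (apex F v) \<in> Range (map_prod f f ` F)"
    then obtain u w where "(u, w) \<in> F" "f w = f (apex F v)" by auto
    then have "w = apex F v"
      using assms(2-4) apex_in[OF assms(1,2,4)] by (auto dest: inj_onD)
    then show False using \<open>(u, w) \<in> F\<close> apex_notin_Range[OF assms(1), of v] by blast
  qed
qed

lemma contract_arcs_map:
  assumes "branching F" "F \<subseteq> V \<times> V" "A \<subseteq> V \<times> V" "inj_on f V"
  shows "contract_arcs (map_prod f f ` F) (map_prod f f ` A) = map_prod f f ` contract_arcs F A"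
proof -
  have "inj_on (map_prod f f) (V \<times> V)" using assms(4) by (rule map_prod_inj_on[OF _ assms(4)])
  moreover have "A - F \<subseteq> V \<times> V" using assms(3) by blast
  ultimately have "map_prod f f ` A - map_prod f f ` F = map_prod f f ` (A - F)"
    using assms(2) by (rule inj_on_image_set_diff[symmetric])
  then have "contract_arcs (map_prod f f ` F) (map_prod f f ` A) =
      (\<lambda>e. map_prod (apex (map_prod f f ` F)) (apex (map_prod f f ` F)) (map_prod f f e)) ` (A - F)"
    by (simp add: contract_arcs_def image_image)
  also have "\<dots> = (\<lambda>e. map_prod f f (map_prod (apex F) (apex F) e)) ` (A - F)"
    by (rule image_cong) (use assms(3) in \<open>auto simp: apex_map[OF assms(1,2,4)]\<close>)
  also have "\<dots> = map_prod f f ` contract_arcs F A"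
    by (simp add: contract_arcs_def image_image)
  finally show ?thesis .
qed

section \<open>Rooted trees as branchings\<close>

lemma connected_with_proj_iff:
  assumes "parcs t \<subseteq> pverts t \<times> pverts t"
  shows "connected (with_proj t) \<longleftrightarrow>
    pverts t \<noteq> {} \<and> (\<forall>u\<in>pverts t. \<forall>v\<in>pverts t. (u, v) \<in> (parcs t \<union> (parcs t)\<inverse>)\<^sup>*)"
proof -
  have *: "parcs (mk_symmetric (with_proj t)) = parcs t \<union> (parcs t)\<inverse>"
    by (auto simp: mk_symmetric_def)
  have "(u, v) \<in> rtrancl_on (pverts t) (parcs t \<union> (parcs t)\<inverse>) \<longleftrightarrow>
      (u, v) \<in> (parcs t \<union> (parcs t)\<inverse>)\<^sup>*" if "u \<in> pverts t" "v \<in> pverts t" for u v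
  proof
    assume "(u, v) \<in> (parcs t \<union> (parcs t)\<inverse>)\<^sup>*"
    then show "(u, v) \<in> rtrancl_on (pverts t) (parcs t \<union> (parcs t)\<inverse>)"
      by (rule rtrancl_consistent_rtrancl_on) (use that assms in auto)
  qed (rule rtrancl_on_rtranclI)
  then show ?thesis
    unfolding connected_def strongly_connected_def reachable_def
    by (simp add: *)
qed

lemma del_arc_with_proj:
  "pre_digraph.del_arc (with_proj t) e = with_proj \<lparr> pverts = pverts t, parcs = parcs t - {e} \<rparr>"
  by (simp add: pre_digraph.del_arc_def with_proj_def)

lemma in_degree_with_proj: "in_degree (with_proj t) v = card {e \<in> parcs t. snd e = v}"
  by (simp add: in_degree_def in_arcs_def)

text \<open>
  The set of vertices reachable from the root is closed under arcs in both directions: the tail of an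
  arc into a reachable vertex \<open>v\<close> is the last vertex before \<open>v\<close> on a path from the root, since \<open>v\<close>
  has no other incoming arc. By connectedness every vertex is reachable, and the same induction along paths
  from the root excludes directed cycles.
\<close>

lemma rooted_treeD:
  assumes "rooted_tree t"
  shows "finite (pverts t)" "parcs t \<subseteq> pverts t \<times> pverts t" "branching (parcs t)"
    "\<exists>r\<in>pverts t. \<forall>v\<in>pverts t. (r, v) \<in> (parcs t)\<^sup>*"
proof -
  let ?A = "parcs t" and ?V = "pverts t"
  interpret t: pair_fin_digraph t using assms by (simp add: rooted_tree_def)
  show fin: "finite ?V" by (rule t.pair_finite_verts)
  show sub: "?A \<subseteq> ?V \<times> ?V" using t.arc_fst_in_verts t.arc_snd_in_verts by fastforce
  obtain r where r: "r \<in> ?V" "in_degree (with_proj t) r = 0"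
    "\<And>v. v \<in> ?V - {r} \<Longrightarrow> in_degree (with_proj t) v = 1"
    using assms by (auto simp: rooted_tree_def)
  have root: "(u, r) \<notin> ?A" for u
  proof -
    have "{e \<in> ?A. snd e = r} = {}"
      using r(2) t.pair_finite_arcs by (auto simp: in_degree_with_proj)
    then show ?thesis by auto
  qed
  have parent: "u = u'" if "(u, v) \<in> ?A" "(u', v) \<in> ?A" for u u' v
  proof -
    have "v \<in> ?V - {r}" using that sub root by auto
    then obtain e where "{e \<in> ?A. snd e = v} = {e}"
      using r(3)[of v] unfolding in_degree_with_proj by (meson card_1_singletonE)
    moreover have "(u, v) \<in> {e \<in> ?A. snd e = v}" "(u', v) \<in> {e \<in> ?A. snd e = v}"
      using that by simp_all
    ultimately have "(u, v) = e" "(u', v) = e" by blast+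
    then show ?thesis by blast
  qed
  have conn: "(r, v) \<in> (?A \<union> ?A\<inverse>)\<^sup>*" if "v \<in> ?V" for v
    using assms r(1) that connected_with_proj_iff[OF sub]
    by (auto simp: rooted_tree_def simply_connected_digraph_def)
  have reach: "(r, v) \<in> ?A\<^sup>*" if "(r, v) \<in> (?A \<union> ?A\<inverse>)\<^sup>*" for v
    using that
  proof induction
    case (step y z)
    show ?case
    proof (cases "(y, z) \<in> ?A")
      case False
      then have "(z, y) \<in> ?A" using step by auto
      moreover have "y \<noteq> r" using root \<open>(z, y) \<in> ?A\<close> by auto
      ultimately show ?thesis
        using step.IH parent by (auto elim: rtranclE)
    qed (use step in auto)
  qed simp
  have "(v, v) \<notin> ?A\<^sup>+" if "(r, v) \<in> ?A\<^sup>*" for v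
    using that
  proof induction
    case base
    then show ?case using root by (auto elim: tranclE)
  next
    case (step y z)
    show ?case
    proof
      assume "(z, z) \<in> ?A\<^sup>+"
      then obtain w where "(z, w) \<in> ?A\<^sup>*" "(w, z) \<in> ?A" by (auto dest: tranclD2)
      then have "w = y" using step parent by auto
      then have "(y, y) \<in> ?A\<^sup>+" using \<open>(z, w) \<in> ?A\<^sup>*\<close> step(2) by auto
      then show False using step by auto
    qed
  qed
  moreover have "(v, v) \<notin> ?A\<^sup>+" if "v \<notin> ?V" for v
    using that sub by (auto elim: tranclE)
  ultimately have "acyclic ?A" using conn reach by (auto simp: acyclic_def)
  then show "branching ?A"
    using parent t.pair_finite_arcs by (auto simp: branching_def single_valued_def)
  show "\<exists>r\<in>?V. \<forall>v\<in>?V. (r, v) \<in> ?A\<^sup>*" using r(1) conn reach by auto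
qed

text \<open>
  An arc \<open>(u, v)\<close> is a bridge because the set of descendants of \<open>v\<close> is closed under the remaining
  arcs in both directions and does not contain the root.
\<close>

lemma rooted_treeI:
  assumes "finite (pverts t)" "parcs t \<subseteq> pverts t \<times> pverts t" "branching (parcs t)"
    "r \<in> pverts t" "\<And>v. v \<in> pverts t \<Longrightarrow> (r, v) \<in> (parcs t)\<^sup>*"
  shows "rooted_tree t"
proof -
  let ?A = "parcs t" and ?V = "pverts t"
  have acyclic: "(v, v) \<notin> ?A\<^sup>+" for v using assms(3) by (auto simp: branching_def acyclic_def)
  have root: "(u, r) \<notin> ?A" for u
    using assms(2,5) acyclic[of r] by (auto dest: rtrancl_into_trancl1)
  have "pair_fin_digraph t"
    by unfold_locales (use assms(1,2,3) in \<open>auto simp: branching_def\<close>)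
  moreover have "connected (with_proj t)"
  proof -
    have "(r, v) \<in> (?A \<union> ?A\<inverse>)\<^sup>*" "(v, r) \<in> (?A \<union> ?A\<inverse>)\<^sup>*" if "v \<in> ?V" for v
    proof -
      show "(r, v) \<in> (?A \<union> ?A\<inverse>)\<^sup>*"
        using assms(5)[OF that] by (rule rtrancl_mono[THEN subsetD, rotated]) auto
      have "(v, r) \<in> (?A\<inverse>)\<^sup>*" using assms(5)[OF that] by (simp add: rtrancl_converse)
      then show "(v, r) \<in> (?A \<union> ?A\<inverse>)\<^sup>*"
        by (rule rtrancl_mono[THEN subsetD, rotated]) auto
    qed
    then show ?thesis
      unfolding connected_with_proj_iff[OF assms(2)] using assms(4) by (blast intro: rtrancl_trans)
  qed
  moreover have "\<not> connected (pre_digraph.del_arc (with_proj t) e)" if "e \<in> ?A" for e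
  proof
    obtain u v where e: "e = (u, v)" by (cases e)
    let ?B = "?A - {e}"
    assume "connected (pre_digraph.del_arc (with_proj t) e)"
    then have conn: "(v, r) \<in> (?B \<union> ?B\<inverse>)\<^sup>*"
      using assms(2,4) that e
      by (subst (asm) del_arc_with_proj, subst (asm) connected_with_proj_iff) auto
    \<comment> \<open>Going against an arc never leads above \<open>v\<close>, as the only arc into \<open>v\<close> has been deleted.\<close>
    have "(v, w) \<in> ?A\<^sup>*" if "(v, w) \<in> (?B \<union> ?B\<inverse>)\<^sup>*" for w
      using that
    proof induction
      case (step y z)
      show ?case
      proof (cases "(y, z) \<in> ?B")
        case False
        then have zy: "(z, y) \<in> ?A" "(z, y) \<noteq> (u, v)" using step e by auto
        then have "y \<noteq> v" 
          using branching_parent_unique[OF assms(3)] \<open>e \<in> ?A\<close> e by blast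
        then show ?thesis
          using step.IH zy branching_parent_unique[OF assms(3)] by (blast elim: rtranclE)
      qed (use step in auto)
    qed simp
    then have "(v, r) \<in> ?A\<^sup>*" using conn by blast
    then have "v = r" using root by (blast elim: rtranclE)
    then show False using root that e by blast
  qed
  moreover have "in_degree (with_proj t) r = 0"
  proof -
    have "{e \<in> ?A. snd e = r} = {}" using root by auto
    then show ?thesis by (simp only: in_degree_with_proj card.empty)
  qed
  moreover have "in_degree (with_proj t) v = 1" if "v \<in> ?V - {r}" for v
  proof -
    have "(r, v) \<in> ?A\<^sup>*" "v \<noteq> r" using assms(5) that by auto
    then obtain u where "(u, v) \<in> ?A" by (blast elim: rtranclE)
    then have "{e \<in> ?A. snd e = v} = {(u, v)}"
      using branching_parent_unique[OF assms(3)] by auto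
    then show ?thesis by (simp add: in_degree_with_proj del: Collect_conj_eq)
  qed
  ultimately show ?thesis
    using assms(4) by (auto simp: rooted_tree_def simply_connected_digraph_def)
qed

lemma root_of:
  assumes "rooted_tree t"
  shows "root_of t \<in> pverts t" "root_of t \<notin> Range (parcs t)"
    "v \<in> pverts t \<Longrightarrow> (root_of t, v) \<in> (parcs t)\<^sup>*"
proof -
  note t = rooted_treeD[OF assms]
  obtain r where r: "r \<in> pverts t" "\<forall>v\<in>pverts t. (r, v) \<in> (parcs t)\<^sup>*"
    using t(4) by blast
  have "finite (parcs t)" using t(3) by (simp add: branching_def)
  then have deg: "in_degree (with_proj t) v = 0 \<longleftrightarrow> v \<notin> Range (parcs t)" for v
    by (force simp: in_degree_with_proj)
  have no_arc: "r \<notin> Range (parcs t)"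
  proof
    assume "r \<in> Range (parcs t)"
    then obtain u where u: "(u, r) \<in> parcs t" by blast
    then have "(r, u) \<in> (parcs t)\<^sup>*" using r(2) t(2) by blast
    then have "(r, r) \<in> (parcs t)\<^sup>+" using u by (rule rtrancl_into_trancl1)
    then show False using t(3) by (auto simp: branching_def acyclic_def)
  qed
  have "root_of t = r"
    unfolding root_of_def deg
  proof (rule the_equality)
    show "r \<in> pverts t \<and> r \<notin> Range (parcs t)" using r(1) no_arc by blast
    show "r' = r" if "r' \<in> pverts t \<and> r' \<notin> Range (parcs t)" for r'
      using rtrancl_root[of r r' "parcs t"] r(2) that by blast
  qed
  then show "root_of t \<in> pverts t" "root_of t \<notin> Range (parcs t)"
    "v \<in> pverts t \<Longrightarrow> (root_of t, v) \<in> (parcs t)\<^sup>*"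
    using r no_arc by auto
qed

lemma rooted_tree_wf: "rooted_tree t \<Longrightarrow> wf_digraph (with_proj t)"
  using rooted_treeD(2)[of t] by unfold_locales auto

section \<open>Rooted forests as branchings\<close>

text \<open>
  The vertex set \<open>W\<close> is a parameter because a single-vertex tree leaves no trace in the arc relation
  \<open>F\<close>.
\<close>

definition component :: "'a set \<Rightarrow> 'a rel \<Rightarrow> 'a \<Rightarrow> 'a pair_pre_digraph" where
  "component W F r =
     \<lparr> pverts = {v \<in> W. apex F v = r}, parcs = {(u, v). (u, v) \<in> F \<and> apex F v = r} \<rparr>"

definition forest_of :: "'a set \<Rightarrow> 'a rel \<Rightarrow> 'a pair_pre_digraph set" where
  "forest_of W F = component W F ` apex F ` W"

definition forest_verts :: "'a pair_pre_digraph set \<Rightarrow> 'a set" where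
  "forest_verts s = \<Union> (pverts ` s)"

definition forest_arcs :: "'a pair_pre_digraph set \<Rightarrow> 'a rel" where
  "forest_arcs s = \<Union> (parcs ` s)"

lemma rooted_tree_component:
  assumes "finite W" "F \<subseteq> W \<times> W" "branching F" "v \<in> W"
  shows "rooted_tree (component W F (apex F v))"
proof -
  let ?C = "component W F (apex F v)"
  have sub: "parcs ?C \<subseteq> F" by (auto simp: component_def)
  have path: "(u, w) \<in> (parcs ?C)\<^sup>*" if "(u, w) \<in> F\<^sup>*" "apex F w = apex F v" for u w
    using that
  proof induction
    case (step y z)
    then have "(y, z) \<in> parcs ?C" "apex F y = apex F v"
      using apex_arc[OF assms(3)] by (auto simp: component_def)
    then show ?case using step by auto
  qed simp
  show ?thesis
  proof (rule rooted_treeI)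
    show "finite (pverts ?C)" using assms(1) by (simp add: component_def)
    show "parcs ?C \<subseteq> pverts ?C \<times> pverts ?C"
      using assms(2) apex_arc[OF assms(3)] by (auto simp: component_def)
    show "branching (parcs ?C)" by (rule branching_subset[OF assms(3) sub])
    show "apex F v \<in> pverts ?C"
      using apex_in[OF assms(3,2,4)] by (simp add: component_def apex_apex_subset assms(3))
    show "(apex F v, w) \<in> (parcs ?C)\<^sup>*" if "w \<in> pverts ?C" for w
      using apex_reaches[OF assms(3), of w] that by (intro path) (auto simp: component_def)
  qed
qed

lemma forest_verts_forest_of [simp]: "forest_verts (forest_of W F) = W"
  by (auto simp: forest_verts_def forest_of_def component_def)

lemma forest_arcs_forest_of [simp]: "F \<subseteq> W \<times> W \<Longrightarrow> forest_arcs (forest_of W F) = F"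
  by (force simp: forest_arcs_def forest_of_def component_def)

lemma rooted_forest_forest_of:
  assumes "finite W" "F \<subseteq> W \<times> W" "branching F"
  shows "rooted_forest (forest_of W F)"
  using assms rooted_tree_component[OF assms]
  by (auto simp: rooted_forest_def forest_of_def pairwise_def disjnt_def component_def)

context
  fixes s :: "'a pair_pre_digraph set"
  assumes s: "rooted_forest s"
begin

lemma forest_tree_unique: "T \<in> s \<Longrightarrow> T' \<in> s \<Longrightarrow> v \<in> pverts T \<Longrightarrow> v \<in> pverts T' \<Longrightarrow> T = T'"
  using s by (force simp: rooted_forest_def pairwise_def disjnt_def)

lemma forest_tree: "T \<in> s \<Longrightarrow> rooted_tree T"
  using s by (simp add: rooted_forest_def)

text \<open>
  Trees of a forest share no vertices, so an arc of the forest belongs to the tree of either of its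
  ends.
\<close>

lemma forest_arc_in_tree:
  assumes "(u, v) \<in> forest_arcs s" "T \<in> s" "u \<in> pverts T \<or> v \<in> pverts T"
  shows "(u, v) \<in> parcs T"
proof -
  obtain T' where T': "T' \<in> s" "(u, v) \<in> parcs T'" using assms(1) by (auto simp: forest_arcs_def)
  then have "u \<in> pverts T'" "v \<in> pverts T'" using rooted_treeD(2)[OF forest_tree] by auto
  then have "T' = T" using assms(2,3) T'(1) forest_tree_unique by blast
  then show ?thesis using T' by simp
qed

lemma forest_arcs_subset: "forest_arcs s \<subseteq> forest_verts s \<times> forest_verts s"
  using rooted_treeD(2)[OF forest_tree] by (fastforce simp: forest_arcs_def forest_verts_def)

lemma finite_forest_verts: "finite (forest_verts s)"
  using s rooted_treeD(1)[OF forest_tree] by (auto simp: forest_verts_def rooted_forest_def)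

text \<open>
  By \<open>forest_arc_in_tree\<close>, parents are taken within one tree and a path that starts in a tree stays in
  it, so both properties are inherited from the trees.
\<close>

lemma branching_forest_arcs: "branching (forest_arcs s)"
  unfolding branching_def
proof (intro conjI)
  show "finite (forest_arcs s)"
    using finite_subset[OF forest_arcs_subset] finite_forest_verts by blast
  show "single_valued ((forest_arcs s)\<inverse>)"
  proof (rule single_valuedI)
    fix v u u' assume uv: "(v, u) \<in> (forest_arcs s)\<inverse>" "(v, u') \<in> (forest_arcs s)\<inverse>"
    then obtain T where T: "T \<in> s" "(u, v) \<in> parcs T" by (auto simp: forest_arcs_def)
    then have "v \<in> pverts T" using rooted_treeD(2)[OF forest_tree] by auto
    then have "(u', v) \<in> parcs T" using uv T by (auto intro: forest_arc_in_tree)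
    then show "u = u'"
      using branching_parent_unique[OF rooted_treeD(3)[OF forest_tree[OF T(1)]]] T(2) by blast
  qed
  have path: "(u, v) \<in> (parcs T)\<^sup>+ \<and> v \<in> pverts T"
    if "T \<in> s" "u \<in> pverts T" "(u, v) \<in> (forest_arcs s)\<^sup>+" for T u v
    using that(3)
  proof induction
    case (base v)
    then have "(u, v) \<in> parcs T" using that by (auto intro: forest_arc_in_tree)
    then show ?case using rooted_treeD(2)[OF forest_tree[OF that(1)]] by auto
  next
    case (step y z)
    then have "(y, z) \<in> parcs T" using that by (auto intro: forest_arc_in_tree)
    then show ?case using step rooted_treeD(2)[OF forest_tree[OF that(1)]] by auto
  qed
  show "acyclic (forest_arcs s)"
  proof (rule acyclicI, intro allI notI)
    fix v assume v: "(v, v) \<in> (forest_arcs s)\<^sup>+"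
    then obtain u where "(v, u) \<in> forest_arcs s" by (auto dest: tranclD)
    then obtain T where T: "T \<in> s" "v \<in> pverts T"
      using forest_arcs_subset by (auto simp: forest_verts_def)
    then show False
      using path[OF T v] rooted_treeD(3)[OF forest_tree[OF T(1)]]
      by (auto simp: branching_def acyclic_def)
  qed
qed

lemma apex_forest_arcs:
  assumes "T \<in> s" "v \<in> pverts T"
  shows "apex (forest_arcs s) v = root_of T"
proof (rule apex_eqI[OF branching_forest_arcs])
  note T = forest_tree[OF assms(1)]
  have "parcs T \<subseteq> forest_arcs s" using assms(1) by (auto simp: forest_arcs_def)
  then show "(root_of T, v) \<in> (forest_arcs s)\<^sup>*"
    using root_of(3)[OF T assms(2)] rtrancl_mono by blast
  show "root_of T \<notin> Range (forest_arcs s)"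
    using root_of(1,2)[OF T] forest_arc_in_tree[OF _ assms(1)] by blast
qed

lemma component_forest:
  assumes "T \<in> s"
  shows "component (forest_verts s) (forest_arcs s) (root_of T) = T"
proof -
  have same: "v \<in> pverts T"
    if v: "v \<in> forest_verts s" "apex (forest_arcs s) v = root_of T" for v
  proof -
    obtain T' where T': "T' \<in> s" "v \<in> pverts T'" using v(1) by (auto simp: forest_verts_def)
    then have "root_of T' = root_of T" using apex_forest_arcs v(2) by auto
    then have "T' = T"
      using forest_tree_unique[OF T'(1) assms, of "root_of T"] root_of(1)[OF forest_tree[OF T'(1)]]
        root_of(1)[OF forest_tree[OF assms]] by simp
    then show ?thesis using T' by simp
  qed
  have "{v \<in> forest_verts s. apex (forest_arcs s) v = root_of T} = pverts T"
    using same apex_forest_arcs[OF assms] assms by (auto simp: forest_verts_def)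
  moreover have "{(u, v). (u, v) \<in> forest_arcs s \<and> apex (forest_arcs s) v = root_of T} = parcs T"
  proof (intro set_eqI iffI; clarify)
    fix u v assume uv: "(u, v) \<in> forest_arcs s" "apex (forest_arcs s) v = root_of T"
    then have "v \<in> pverts T" using same forest_arcs_subset by blast
    then show "(u, v) \<in> parcs T" using forest_arc_in_tree[OF uv(1) assms] by blast
  next
    fix u v assume uv: "(u, v) \<in> parcs T"
    then have "v \<in> pverts T" using rooted_treeD(2)[OF forest_tree[OF assms]] by blast
    then show "(u, v) \<in> forest_arcs s \<and> apex (forest_arcs s) v = root_of T"
      using apex_forest_arcs[OF assms] uv assms by (auto simp: forest_arcs_def)
  qed
  ultimately show ?thesis by (simp add: component_def)
qed

text \<open>
  With \<open>forest_verts_forest_of\<close> and \<open>forest_arcs_forest_of\<close>, this makes a rooted forest the same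
  thing as a pair of a finite vertex set and a branching on it.
\<close>

lemma forest_of_verts_arcs: "forest_of (forest_verts s) (forest_arcs s) = s"
proof -
  have "apex (forest_arcs s) ` forest_verts s = root_of ` s"
  proof
    show "apex (forest_arcs s) ` forest_verts s \<subseteq> root_of ` s"
      using apex_forest_arcs by (auto simp: forest_verts_def)
    show "root_of ` s \<subseteq> apex (forest_arcs s) ` forest_verts s"
    proof (rule image_subsetI)
      fix T assume T: "T \<in> s"
      note r = root_of(1)[OF forest_tree[OF T]]
      have "root_of T = apex (forest_arcs s) (root_of T)" using apex_forest_arcs[OF T r] by simp
      then show "root_of T \<in> apex (forest_arcs s) ` forest_verts s"
        using T r unfolding forest_verts_def by blast
    qed
  qed
  then show ?thesis by (simp add: forest_of_def image_image component_forest)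
qed

lemma collapse_eq_apex: "collapse s = apex (forest_arcs s)"
proof
  fix v
  show "collapse s v = apex (forest_arcs s) v"
  proof (cases "\<exists>T\<in>s. v \<in> pverts T")
    case True
    then obtain T where T: "T \<in> s" "v \<in> pverts T" by blast
    then have "(THE T. T \<in> s \<and> v \<in> pverts T) = T" by (auto intro: forest_tree_unique)
    then show ?thesis using True apex_forest_arcs[OF T] by (simp add: collapse_def)
  next
    case False
    then have "v \<notin> Range (forest_arcs s)" using forest_arcs_subset by (auto simp: forest_verts_def)
    then show ?thesis using False branching_forest_arcs by (simp add: collapse_def)
  qed
qed

lemma contract_eq:
  "contract s t = \<lparr> pverts = apex (forest_arcs s) ` pverts t, parcs = contract_arcs (forest_arcs s) (parcs t) \<rparr>"
  by (simp add: contract_def collapse_eq_apex contract_arcs_def forest_arcs_def)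

text \<open>
  A tree of \<open>s'\<close> is connected by arcs of \<open>s\<close>, hence it cannot leave the tree of \<open>s\<close> that
  contains its root.
\<close>

lemma subforest_iff:
  "subforest s' s \<longleftrightarrow>
    rooted_forest s' \<and> forest_verts s' \<subseteq> forest_verts s \<and> forest_arcs s' \<subseteq> forest_arcs s"
proof
  assume "subforest s' s"
  then show "rooted_forest s' \<and> forest_verts s' \<subseteq> forest_verts s \<and> forest_arcs s' \<subseteq> forest_arcs s"
    by (fastforce simp: subforest_def forest_verts_def forest_arcs_def subgraph_def)
next
  assume *: "rooted_forest s' \<and> forest_verts s' \<subseteq> forest_verts s \<and> forest_arcs s' \<subseteq> forest_arcs s"
  have "\<exists>T'\<in>s. subgraph (with_proj T) (with_proj T')" if T: "T \<in> s'" for T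
  proof -
    have t: "rooted_tree T" using * T by (simp add: rooted_forest_def)
    have arcs: "parcs T \<subseteq> forest_arcs s" using * T by (auto simp: forest_arcs_def)
    obtain T' where T': "T' \<in> s" "root_of T \<in> pverts T'"
      using * T root_of(1)[OF t] by (auto simp: forest_verts_def)
    note t' = forest_tree[OF T'(1)]
    have in_T': "v \<in> pverts T'" if "(root_of T, v) \<in> (parcs T)\<^sup>*" for v
      using that
    proof induction
      case (step y z)
      then have "(y, z) \<in> parcs T'" using arcs T'(1) by (auto intro: forest_arc_in_tree)
      then show ?case using rooted_treeD(2)[OF t'] by auto
    qed (rule T'(2))
    have verts: "pverts T \<subseteq> pverts T'" using in_T' root_of(3)[OF t] by blast
    moreover have "parcs T \<subseteq> parcs T'"
    proof clarify
      fix u v assume uv: "(u, v) \<in> parcs T"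
      then have "v \<in> pverts T'" using verts rooted_treeD(2)[OF t] by blast
      then show "(u, v) \<in> parcs T'" using uv arcs T'(1) by (auto intro: forest_arc_in_tree)
    qed
    ultimately have "subgraph (with_proj T) (with_proj T')"
      using rooted_tree_wf[OF t] rooted_tree_wf[OF t'] by (auto simp: subgraph_def)
    then show ?thesis using T'(1) by blast
  qed
  then show "subforest s' s" using * by (simp add: subforest_def)
qed

end

section \<open>Couples\<close>

text \<open>
  Here \<open>W\<close> and \<open>F\<close> are the vertices and arcs of the subforest of a couple. They determine it: as
  a part of the branching \<open>parcs t\<close>, \<open>F\<close> is a branching on \<open>W\<close>.
\<close>

definition couple_data :: "'a pair_pre_digraph \<Rightarrow> 'a set \<Rightarrow> 'a rel \<Rightarrow> bool" where
  "couple_data t W F \<longleftrightarrow> rooted_tree t \<and> W \<subseteq> pverts t \<and> F \<subseteq> parcs t \<and> F \<subseteq> W \<times> W"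

definition quotient_tree :: "'a rel \<Rightarrow> 'a pair_pre_digraph \<Rightarrow> 'a pair_pre_digraph" where
  "quotient_tree F t = \<lparr> pverts = apex F ` pverts t, parcs = contract_arcs F (parcs t) \<rparr>"

definition couple_of :: "nat pair_pre_digraph \<Rightarrow> nat set \<Rightarrow> nat rel \<Rightarrow> couple" where
  "couple_of t W F = abs_couple (t, forest_of W F)"

lemma couple_dataD:
  assumes "couple_data t W F"
  shows "rooted_tree t" "W \<subseteq> pverts t" "F \<subseteq> parcs t" "F \<subseteq> W \<times> W" "finite W" "branching F"
    "branching (parcs t)"
  using assms rooted_treeD[of t] branching_subset[of "parcs t" F]
  by (auto simp: couple_data_def intro: finite_subset)

lemma couple_data_subset: "couple_data t W F \<Longrightarrow> F' \<subseteq> F \<Longrightarrow> couple_data t W F'"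
  by (auto simp: couple_data_def)

lemma forest_couple_data:
  assumes "couple_data t W F"
  shows "rooted_forest (forest_of W F)" "forest_verts (forest_of W F) = W"
    "forest_arcs (forest_of W F) = F"
  using couple_dataD[OF assms] by (auto intro: rooted_forest_forest_of)

lemma is_couple_iff:
  "is_couple (t, s) \<longleftrightarrow> rooted_forest s \<and> couple_data t (forest_verts s) (forest_arcs s)"
proof (cases "rooted_tree t")
  case True
  then have t: "rooted_forest {t}" by (simp add: rooted_forest_def)
  show ?thesis
    using True subforest_iff[OF t, of s] forest_arcs_subset[of s]
    by (auto simp: is_couple_def couple_data_def forest_verts_def[of "{t}"] forest_arcs_def[of "{t}"])
qed (simp add: is_couple_def couple_data_def)

lemma is_couple_forest_of: "couple_data t W F \<Longrightarrow> is_couple (t, forest_of W F)"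
  by (simp add: is_couple_iff forest_couple_data)

lemma couple_of_cases:
  obtains t W F where "couple_data t W F" "c = couple_of t W F"
proof (induction c rule: couple.abs_induct)
  case (1 y)
  obtain t s where y: "y = (t, s)" by (cases y)
  then have "is_couple (t, s)" using 1 by (auto simp: couple_iso_def)
  then show ?thesis
    using 1(2)[of t "forest_verts s" "forest_arcs s"]
    by (simp add: is_couple_iff y couple_of_def forest_of_verts_arcs)
qed

text \<open>
  A covering subforest has the vertices of the forest, so it amounts to a choice of arcs. The sum that
  defines the coproduct is thus a sum over all the subsets of \<open>F\<close>.
\<close>

lemma covering_subforest_forest_of_iff:
  assumes "couple_data t W F"
  shows "covering_subforest s' (forest_of W F) \<longleftrightarrow> (\<exists>F'\<subseteq>F. s' = forest_of W F')"
proof -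
  note s = forest_couple_data[OF assms]
  have verts: "\<Union> (pverts ` s) = forest_verts s" for s :: "'a pair_pre_digraph set"
    by (simp add: forest_verts_def)
  have "covering_subforest s' (forest_of W F) \<longleftrightarrow>
      rooted_forest s' \<and> forest_verts s' = W \<and> forest_arcs s' \<subseteq> F"
    by (auto simp: covering_subforest_def verts subforest_iff[OF s(1)] s)
  also have "\<dots> \<longleftrightarrow> (\<exists>F'\<subseteq>F. s' = forest_of W F')"
    using forest_couple_data[OF couple_data_subset[OF assms]] forest_of_verts_arcs[of s'] by metis
  finally show ?thesis .
qed

text \<open>
  The contracted relation \<open>F\<close> may consist of arcs of a branching \<open>A\<close> that is larger than \<open>t\<close>.
  In this form the lemma also covers the contraction of a tree \<open>T\<close> of \<open>s\<close> by all of \<open>s'\<close>.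
\<close>

lemma rooted_tree_quotient:
  assumes "rooted_tree t" "branching A" "parcs t \<subseteq> A" "F \<subseteq> A"
  shows "rooted_tree (quotient_tree F t)"
proof (rule rooted_treeI)
  note t = rooted_treeD[OF assms(1)] and F = branching_subset[OF assms(2,4)]
  show "finite (pverts (quotient_tree F t))" using t(1) by (simp add: quotient_tree_def)
  show "parcs (quotient_tree F t) \<subseteq> pverts (quotient_tree F t) \<times> pverts (quotient_tree F t)"
    using t(2) by (auto simp: quotient_tree_def contract_arcs_def)
  show "branching (parcs (quotient_tree F t))"
    using branching_subset[OF branching_contract_arcs[OF assms(2,4)] contract_arcs_mono[OF assms(3)]]
    by (simp add: quotient_tree_def)
  show "apex F (root_of t) \<in> pverts (quotient_tree F t)"
    using root_of(1)[OF assms(1)] by (simp add: quotient_tree_def)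
  show "(apex F (root_of t), v) \<in> (parcs (quotient_tree F t))\<^sup>*"
    if "v \<in> pverts (quotient_tree F t)" for v
    using that root_of(3)[OF assms(1)] rtrancl_contract_arcs[OF F]
    by (auto simp: quotient_tree_def)
qed

lemma couple_data_quotient:
  assumes "couple_data t W F" "F' \<subseteq> F"
  shows "couple_data (quotient_tree F' t) (apex F' ` W) (contract_arcs F' F)"
  using couple_dataD[OF assms(1)] assms(2) rooted_tree_quotient[of t "parcs t" F']
    contract_arcs_mono[of F "parcs t" F']
  by (auto simp: couple_data_def quotient_tree_def contract_arcs_def)

lemma contract_forest_of:
  assumes "couple_data t W F"
  shows "contract (forest_of W F) T = quotient_tree F T"
  by (simp add: contract_eq forest_couple_data[OF assms] quotient_tree_def)

text \<open>
  Contraction moves a vertex only within its \<open>F\<close>-component, so the trees of \<open>s\<close> remain disjoint,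
  and a forest is determined by its vertices and arcs.
\<close>

lemma contract_image_forest_of:
  assumes "couple_data t W F" "F' \<subseteq> F"
  shows "contract (forest_of W F') ` forest_of W F = forest_of (apex F' ` W) (contract_arcs F' F)"
proof -
  note F = couple_dataD[OF assms(1)] and s = forest_couple_data[OF assms(1)]
  let ?s = "quotient_tree F' ` forest_of W F"
  have tree: "rooted_tree T" "parcs T \<subseteq> F" if "T \<in> forest_of W F" for T
    using that s(1,3) by (auto simp: rooted_forest_def forest_arcs_def)
  have apex: "apex F x = r" if "x \<in> pverts (quotient_tree F' (component W F r))" for x r
    using that by (auto simp: quotient_tree_def component_def apex_apex_subset[OF F(6) assms(2)])
  have "rooted_forest ?s"
    unfolding rooted_forest_def
  proof (intro conjI ballI)
    show "finite ?s" using s(1) by (simp add: rooted_forest_def)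
    show "rooted_tree T" if "T \<in> ?s" for T
      using that tree rooted_tree_quotient[OF _ F(6) _ assms(2)] by auto
    show "pairwise (\<lambda>T T'. disjnt (pverts T) (pverts T')) ?s"
    proof (rule pairwiseI)
      fix T T' assume *: "T \<in> ?s" "T' \<in> ?s" "T \<noteq> T'"
      then obtain r r' where r: "T = quotient_tree F' (component W F r)"
        "T' = quotient_tree F' (component W F r')"
        unfolding forest_of_def by blast
      then have "r \<noteq> r'" using *(3) by auto
      then show "disjnt (pverts T) (pverts T')"
        using apex[of _ r] apex[of _ r'] unfolding disjnt_iff r by blast
    qed
  qed
  moreover have "forest_verts ?s = apex F' ` forest_verts (forest_of W F)"
    by (auto simp: forest_verts_def quotient_tree_def)
  moreover have "forest_arcs ?s = contract_arcs F' (forest_arcs (forest_of W F))"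
    by (auto simp: forest_arcs_def quotient_tree_def contract_arcs_def)
  ultimately have "?s = forest_of (apex F' ` W) (contract_arcs F' F)"
    using forest_of_verts_arcs[of ?s] s by simp
  then show ?thesis
    by (simp add: contract_forest_of[OF couple_data_subset[OF assms]] cong: image_cong)
qed

section \<open>Invariance under isomorphism\<close>

lemma map_forest_of:
  assumes "branching F" "F \<subseteq> W \<times> W" "inj_on f W"
  shows "map_digraph f ` forest_of W F = forest_of (f ` W) (map_prod f f ` F)"
proof -
  let ?F = "map_prod f f ` F"
  note apex_f = apex_map[OF assms]
  have apex_f_eq: "f (apex F v) = f r \<longleftrightarrow> apex F v = r" if "v \<in> W" "r \<in> W" for v r
    using apex_in[OF assms(1,2) that(1)] that assms(3) by (auto dest: inj_onD)
  have "component (f ` W) ?F (f r) = map_digraph f (component W F r)" if r: "r \<in> W" for r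
  proof -
    have "{x \<in> f ` W. apex ?F x = f r} = f ` {v \<in> W. apex F v = r}"
      using apex_f apex_f_eq r by auto
    moreover have "{(x, y). (x, y) \<in> ?F \<and> apex ?F y = f r} =
        map_prod f f ` {(u, v). (u, v) \<in> F \<and> apex F v = r}"
    proof -
      have "apex ?F (f v) = f r \<longleftrightarrow> apex F v = r" if "(u, v) \<in> F" for u v
        using apex_f apex_f_eq r that assms(2) by auto
      then show ?thesis by force
    qed
    ultimately show ?thesis by (simp add: component_def map_digraph_def)
  qed
  moreover have "apex ?F ` f ` W = f ` apex F ` W"
    using apex_f by (auto simp: image_image)
  ultimately show ?thesis
    using apex_in[OF assms(1,2)] by (auto simp: forest_of_def image_image cong: image_cong)
qed

lemma couple_of_map:
  assumes "couple_data t W F" "inj_on f (pverts t)"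
    and "couple_data (map_digraph f t) (f ` W) (map_prod f f ` F)"
  shows "couple_of (map_digraph f t) (f ` W) (map_prod f f ` F) = couple_of t W F"
proof -
  have "map_digraph f ` forest_of W F = forest_of (f ` W) (map_prod f f ` F)"
    using couple_dataD[OF assms(1)] assms(2) by (intro map_forest_of) (auto intro: inj_on_subset)
  then have "couple_iso (t, forest_of W F)
      (map_digraph f t, forest_of (f ` W) (map_prod f f ` F))"
    using assms is_couple_forest_of by (auto simp: couple_iso_def)
  then show ?thesis
    unfolding couple_of_def using Quotient3_rel_abs[OF Quotient3_couple] by metis
qed

text \<open>
  The coproduct and the number of edges are defined through chosen representatives. By this lemma the
  representative of a couple is the image of any given one under a map that is injective on the
  vertices.
\<close>

lemma rep_couple_of:
  assumes "couple_data t W F"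
  obtains f where "inj_on f (pverts t)"
    "rep_couple (couple_of t W F) = (map_digraph f t, forest_of (f ` W) (map_prod f f ` F))"
    "couple_data (map_digraph f t) (f ` W) (map_prod f f ` F)"
proof -
  note F = couple_dataD[OF assms]
  have "couple_iso (t, forest_of W F) (t, forest_of W F)"
    using is_couple_forest_of[OF assms] map_digraph_id by (auto simp: couple_iso_def intro!: exI[of _ id])
  then have "couple_iso (t, forest_of W F) (rep_couple (couple_of t W F))"
    unfolding couple_of_def by (rule rep_abs_rsp[OF Quotient3_couple])
  then obtain f where f: "inj_on f (pverts t)"
    "rep_couple (couple_of t W F) = (map_digraph f t, map_digraph f ` forest_of W F)"
    "is_couple (map_digraph f t, map_digraph f ` forest_of W F)"
    by (cases "rep_couple (couple_of t W F)") (auto simp: couple_iso_def)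
  have map: "map_digraph f ` forest_of W F = forest_of (f ` W) (map_prod f f ` F)"
    using F f(1) by (intro map_forest_of) (auto intro: inj_on_subset)
  have "map_prod f f ` F \<subseteq> f ` W \<times> f ` W" using F(4) by auto
  then have "couple_data (map_digraph f t) (f ` W) (map_prod f f ` F)"
    using f(3) by (simp add: map is_couple_iff)
  then show thesis using that f map by simp
qed

lemma couple_of_quotient_map:
  assumes "couple_data t W F" "F' \<subseteq> F" "inj_on f (pverts t)"
    and "couple_data (map_digraph f t) (f ` W) (map_prod f f ` F)"
  defines "F1' \<equiv> map_prod f f ` F'"
  shows "couple_of (quotient_tree F1' (map_digraph f t)) (apex F1' ` f ` W)
      (contract_arcs F1' (map_prod f f ` F)) =
    couple_of (quotient_tree F' t) (apex F' ` W) (contract_arcs F' F)"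
proof -
  let ?V = "pverts t"
  note F = couple_dataD[OF assms(1)]
  have F': "branching F'" "F' \<subseteq> ?V \<times> ?V" "F \<subseteq> ?V \<times> ?V" "parcs t \<subseteq> ?V \<times> ?V"
    using branching_subset[OF F(6) assms(2)] F assms(2) rooted_treeD(2)[of t] by auto
  have apex: "apex F1' (f v) = f (apex F' v)" if "v \<in> ?V" for v
    unfolding F1'_def by (rule apex_map[OF F'(1,2) assms(3) that])
  have tree: "quotient_tree F1' (map_digraph f t) = map_digraph f (quotient_tree F' t)"
    using apex contract_arcs_map[OF F'(1,2,4) assms(3)]
    by (auto simp: quotient_tree_def map_digraph_def F1'_def image_image)
  have verts: "apex F1' ` f ` W = f ` apex F' ` W"
    using apex F(2) by (auto simp: image_image subset_iff)
  have arcs: "contract_arcs F1' (map_prod f f ` F) = map_prod f f ` contract_arcs F' F"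
    unfolding F1'_def by (rule contract_arcs_map[OF F'(1-3) assms(3)])
  have "inj_on f (pverts (quotient_tree F' t))"
    using assms(3) apex_in[OF F'(1,2)] by (auto simp: quotient_tree_def intro: inj_on_subset)
  moreover have "couple_data (quotient_tree F1' (map_digraph f t)) (apex F1' ` f ` W)
      (contract_arcs F1' (map_prod f f ` F))"
    unfolding F1'_def using assms(2) by (intro couple_data_quotient[OF assms(4)]) auto
  ultimately show ?thesis
    unfolding tree verts arcs using couple_data_quotient[OF assms(1,2)] by (intro couple_of_map)
qed

text \<open>
  Distinct trees of a forest have disjoint arc sets.
\<close>

lemma couple_edges_couple_of:
  assumes "couple_data t W F"
  shows "couple_edges (couple_of t W F) = card F"
proof -
  obtain f where f: "inj_on f (pverts t)"
    "rep_couple (couple_of t W F) = (map_digraph f t, forest_of (f ` W) (map_prod f f ` F))"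
    "couple_data (map_digraph f t) (f ` W) (map_prod f f ` F)"
    using rep_couple_of[OF assms] .
  note s = forest_couple_data[OF f(3)]
  let ?s = "forest_of (f ` W) (map_prod f f ` F)"
  have "couple_edges (couple_of t W F) = (\<Sum>T\<in>?s. card (parcs T))"
    by (simp add: couple_edges_def f(2))
  also have "\<dots> = card (forest_arcs ?s)"
    unfolding forest_arcs_def
  proof (rule card_UN_disjoint[symmetric])
    show "finite ?s" using s(1) by (simp add: rooted_forest_def)
    have tree: "rooted_tree T" if "T \<in> ?s" for T using s(1) that by (simp add: rooted_forest_def)
    show "\<forall>T\<in>?s. finite (parcs T)"
      using rooted_treeD(3)[OF tree] by (auto simp: branching_def)
    show "\<forall>T\<in>?s. \<forall>T'\<in>?s. T \<noteq> T' \<longrightarrow> parcs T \<inter> parcs T' = {}"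
      using rooted_treeD(2)[OF tree] forest_tree_unique[OF s(1)] by blast
  qed
  also have "\<dots> = card F"
    unfolding s(3)
    by (rule card_image, rule inj_on_subset[OF map_prod_inj_on[OF f(1) f(1)]])
      (use couple_dataD[OF assms] in auto)
  finally show ?thesis .
qed

text \<open>
  The subsets of the transported arc relation are the transports of the subsets of \<open>F\<close>, and each summand
  is invariant under isomorphism.
\<close>

lemma Gamma_couple_couple_of:
  assumes "couple_data t W F"
  shows "(Gamma_couple (couple_of t W F) :: _ \<Rightarrow>\<^sub>0 'k::field) =
    (\<Sum>F'\<in>Pow F. basis ({#couple_of t W F'#},
       {#couple_of (quotient_tree F' t) (apex F' ` W) (contract_arcs F' F)#}))"
proof -
  obtain f where f: "inj_on f (pverts t)"
    "rep_couple (couple_of t W F) = (map_digraph f t, forest_of (f ` W) (map_prod f f ` F))"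
    "couple_data (map_digraph f t) (f ` W) (map_prod f f ` F)"
    using rep_couple_of[OF assms] .
  let ?t = "map_digraph f t" and ?W = "f ` W" and ?F = "map_prod f f ` F"
  have injF: "inj_on (map_prod f f) F"
    by (rule inj_on_subset[OF map_prod_inj_on[OF f(1) f(1)]]) (use couple_dataD[OF assms] in auto)
  have inj_forest: "inj_on (forest_of ?W) (Pow ?F)"
    by (rule inj_onI) (metis PowD couple_data_subset f(3) forest_couple_data(3))
  have covering: "{s'. covering_subforest s' (forest_of ?W ?F)} = forest_of ?W ` Pow ?F"
    using covering_subforest_forest_of_iff[OF f(3)] by auto
  have "(Gamma_couple (couple_of t W F) :: _ \<Rightarrow>\<^sub>0 'k) =
    (\<Sum>s'\<in>forest_of ?W ` Pow ?F. basis ({#abs_couple (?t, s')#},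
       {#abs_couple (contract s' ?t, contract s' ` forest_of ?W ?F)#}))"
    by (simp add: Gamma_couple_def f(2) covering)
  also have "\<dots> = (\<Sum>F'\<in>Pow ?F. basis ({#couple_of ?t ?W F'#},
       {#couple_of (quotient_tree F' ?t) (apex F' ` ?W) (contract_arcs F' ?F)#}))"
    unfolding sum.reindex[OF inj_forest] o_def
  proof (rule sum.cong)
    fix F1 assume "F1 \<in> Pow ?F"
    then have F1: "F1 \<subseteq> ?F" by simp
    show "basis ({#abs_couple (?t, forest_of ?W F1)#},
        {#abs_couple (contract (forest_of ?W F1) ?t, contract (forest_of ?W F1) ` forest_of ?W ?F)#}) =
      basis ({#couple_of ?t ?W F1#},
        {#couple_of (quotient_tree F1 ?t) (apex F1 ` ?W) (contract_arcs F1 ?F)#})"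
      unfolding contract_image_forest_of[OF f(3) F1]
        contract_forest_of[OF couple_data_subset[OF f(3) F1]] couple_of_def ..
  qed simp
  also have "Pow ?F = (`) (map_prod f f) ` Pow F" by (rule image_Pow_surj[symmetric]) simp
  also have "(\<Sum>F'\<in>(`) (map_prod f f) ` Pow F. basis ({#couple_of ?t ?W F'#},
       {#couple_of (quotient_tree F' ?t) (apex F' ` ?W) (contract_arcs F' ?F)#})) =
    (\<Sum>F'\<in>Pow F. basis ({#couple_of t W F'#},
       {#couple_of (quotient_tree F' t) (apex F' ` W) (contract_arcs F' F)#}) :: _ \<Rightarrow>\<^sub>0 'k)"
    unfolding sum.reindex[OF inj_on_image_Pow[OF injF]] o_def
  proof (rule sum.cong)
    fix F' assume "F' \<in> Pow F"
    then have F': "F' \<subseteq> F" by simp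
    have "couple_data ?t ?W (map_prod f f ` F')"
      by (rule couple_data_subset[OF f(3)]) (use F' in auto)
    then show "basis ({#couple_of ?t ?W (map_prod f f ` F')#},
       {#couple_of (quotient_tree (map_prod f f ` F') ?t) (apex (map_prod f f ` F') ` ?W)
           (contract_arcs (map_prod f f ` F') ?F)#}) =
      (basis ({#couple_of t W F'#},
       {#couple_of (quotient_tree F' t) (apex F' ` W) (contract_arcs F' F)#}) :: _ \<Rightarrow>\<^sub>0 'k)"
      using couple_of_map[OF couple_data_subset[OF assms F'] f(1)]
        couple_of_quotient_map[OF assms F' f(1,3)] by simp
  qed simp
  finally show ?thesis .
qed

section \<open>The bialgebra of couples\<close>

lemma apex_empty [simp]: "apex {} = id"
  by (auto simp: apex_def)

lemma quotient_tree_empty [simp]: "quotient_tree {} t = t"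
  by (simp add: quotient_tree_def contract_arcs_def map_prod.id)

lemma contract_arcs_empty [simp]: "contract_arcs {} F = F"
  by (simp add: contract_arcs_def map_prod.id)

lemma quotient_tree_quotient_tree:
  assumes "branching (parcs t)" "F \<subseteq> G" "G \<subseteq> parcs t"
  shows "quotient_tree (contract_arcs F G) (quotient_tree F t) = quotient_tree G t"
  using contract_arcs_contract_arcs[OF assms] apex_contract_arcs[OF branching_subset[OF assms(1,3)] assms(2)]
  by (simp add: quotient_tree_def image_image)

lemma tensor_map_sum_basis:
  "tensor_map f g (\<Sum>i\<in>I. basis (a i, b i)) = (\<Sum>i\<in>I. tensor (f (basis (a i))) (g (basis (b i))))"
  by (simp add: tensor_map_def linear_setsum[OF scale_linear_lin_ext])

lemma tensor_sum_basis_left: "tensor (\<Sum>i\<in>I. basis (a i)) (basis y) = (\<Sum>i\<in>I. basis (a i, y))"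
  by (simp add: tensor_def linear_setsum[OF scale_linear_lin_ext])

lemma tensor_sum_basis_right: "tensor (basis x) (\<Sum>i\<in>I. basis (b i)) = (\<Sum>i\<in>I. basis (x, b i))"
  by (simp add: tensor_def linear_setsum[OF scale_linear_lin_ext])

context
  fixes t :: "nat pair_pre_digraph" and W F
  assumes data: "couple_data t W F"
begin

text \<open>
  These are the two kinds of factors that occur in iterated coproducts of \<open>(t, s)\<close>: for
  \<open>F' \<subseteq> G \<subseteq> F\<close>, where the subforest \<open>s\<^sub>G\<close> has arcs \<open>G\<close>, they are
  \<open>(t, s\<^sub>F\<^sub>')\<close> and \<open>(t / s\<^sub>F\<^sub>', s\<^sub>G / s\<^sub>F\<^sub>')\<close>.
\<close>

abbreviation sub_couple :: "nat rel \<Rightarrow> couple multiset" where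
  "sub_couple F' \<equiv> {#couple_of t W F'#}"

abbreviation quot_couple :: "nat rel \<Rightarrow> nat rel \<Rightarrow> couple multiset" where
  "quot_couple F' G \<equiv> {#couple_of (quotient_tree F' t) (apex F' ` W) (contract_arcs F' G)#}"

lemma finite_arcs: "finite F"
  using couple_dataD[OF data] by (simp add: branching_def)

lemma Gamma_sub_couple:
  assumes "G \<subseteq> F"
  shows "Gamma_coproduct (basis (sub_couple G)) = (\<Sum>F'\<in>Pow G. basis (sub_couple F', quot_couple F' G))"
  by (simp add: Gamma_coproduct_def Gamma_couple_couple_of[OF couple_data_subset[OF data assms]])

text \<open>
  The coproduct sums over the arc sets \<open>H\<close> of covering subforests of \<open>s / s\<^sub>F\<^sub>'\<close>. They are the
  contractions of the \<open>G\<close> with \<open>F' \<subseteq> G \<subseteq> F\<close>, and contracting \<open>F'\<close> and then \<open>H\<close> is contracting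
  \<open>G\<close>.
\<close>

lemma Gamma_quot_couple:
  assumes "F' \<subseteq> F"
  shows "Gamma_coproduct (basis (quot_couple F' F)) =
    (\<Sum>G | F' \<subseteq> G \<and> G \<subseteq> F. basis (quot_couple F' G, quot_couple G F))"
proof -
  note arcs = couple_dataD[OF data]
  note A = branching_subset[OF arcs(6)]
  have "Gamma_coproduct (basis (quot_couple F' F)) =
      (\<Sum>H\<in>Pow (contract_arcs F' F). basis ({#couple_of (quotient_tree F' t) (apex F' ` W) H#},
        {#couple_of (quotient_tree H (quotient_tree F' t)) (apex H ` apex F' ` W)
          (contract_arcs H (contract_arcs F' F))#}))"
    by (simp add: Gamma_coproduct_def Gamma_couple_couple_of[OF couple_data_quotient[OF data assms]])
  also have "\<dots> = (\<Sum>G | F' \<subseteq> G \<and> G \<subseteq> F. basis (quot_couple F' G,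
      {#couple_of (quotient_tree (contract_arcs F' G) (quotient_tree F' t))
        (apex (contract_arcs F' G) ` apex F' ` W)
        (contract_arcs (contract_arcs F' G) (contract_arcs F' F))#}))"
    by (rule sum.reindex_bij_betw[OF bij_betw_contract_arcs[OF arcs(6) assms], symmetric])
  also have "\<dots> = (\<Sum>G | F' \<subseteq> G \<and> G \<subseteq> F. basis (quot_couple F' G, quot_couple G F))"
  proof (rule sum.cong)
    fix G assume "G \<in> {G. F' \<subseteq> G \<and> G \<subseteq> F}"
    then have G: "F' \<subseteq> G" "G \<subseteq> F" by auto
    have "apex (contract_arcs F' G) ` apex F' ` W = apex G ` W"
      by (simp add: image_image apex_contract_arcs[OF A[OF G(2)] G(1)])
    moreover have "quotient_tree (contract_arcs F' G) (quotient_tree F' t) = quotient_tree G t"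
      using G arcs by (intro quotient_tree_quotient_tree) auto
    moreover have "contract_arcs (contract_arcs F' G) (contract_arcs F' F) = contract_arcs G F"
      by (rule contract_arcs_contract_arcs[OF arcs(6) G])
    ultimately show "basis (quot_couple F' G,
      {#couple_of (quotient_tree (contract_arcs F' G) (quotient_tree F' t))
        (apex (contract_arcs F' G) ` apex F' ` W)
        (contract_arcs (contract_arcs F' G) (contract_arcs F' F))#}) =
      basis (quot_couple F' G, quot_couple G F)"
      by simp
  qed simp
  finally show ?thesis .
qed

text \<open>
  Both sides are the sum of \<open>(t, s\<^sub>F\<^sub>') \<otimes> (t / s\<^sub>F\<^sub>', s\<^sub>G / s\<^sub>F\<^sub>') \<otimes> (t / s\<^sub>G, s / s\<^sub>G)\<close> over
  the pairs \<open>F' \<subseteq> G \<subseteq> F\<close>. On the left \<open>G\<close> is chosen first, on the right \<open>F'\<close>.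
\<close>

lemma Gamma_coassoc_couple:
  "tensor_assoc (tensor_map Gamma_coproduct id (Gamma_couple (couple_of t W F))) =
   (tensor_map id Gamma_coproduct (Gamma_couple (couple_of t W F)) :: _ \<Rightarrow>\<^sub>0 'k::field)"
proof -
  have "tensor_assoc (tensor_map Gamma_coproduct id (Gamma_couple (couple_of t W F))) =
    (\<Sum>G\<in>Pow F. \<Sum>F'\<in>Pow G. basis (sub_couple F', (quot_couple F' G, quot_couple G F)) :: _ \<Rightarrow>\<^sub>0 'k)"
    unfolding Gamma_couple_couple_of[OF data] tensor_map_sum_basis tensor_assoc_def
      linear_setsum[OF scale_linear_lin_ext]
    by (rule sum.cong) (simp_all add: Gamma_sub_couple[OF PowD] tensor_sum_basis_left
      linear_setsum[OF scale_linear_lin_ext] del: Pow_iff)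
  also have "\<dots> = (\<Sum>F'\<in>Pow F. \<Sum>G | F' \<subseteq> G \<and> G \<subseteq> F.
      basis (sub_couple F', (quot_couple F' G, quot_couple G F)))"
  proof -
    have "(\<Sum>G\<in>Pow F. \<Sum>F' | F' \<in> Pow F \<and> F' \<subseteq> G.
          basis (sub_couple F', (quot_couple F' G, quot_couple G F)) :: _ \<Rightarrow>\<^sub>0 'k) =
        (\<Sum>F'\<in>Pow F. \<Sum>G | G \<in> Pow F \<and> F' \<subseteq> G.
          basis (sub_couple F', (quot_couple F' G, quot_couple G F)))"
      by (rule sum.swap_restrict) (simp_all add: finite_arcs)
    moreover have "{F'. F' \<in> Pow F \<and> F' \<subseteq> G} = Pow G" if "G \<in> Pow F" for G using that by auto
    moreover have "{G. G \<in> Pow F \<and> F' \<subseteq> G} = {G. F' \<subseteq> G \<and> G \<subseteq> F}" for F' by auto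
    ultimately show ?thesis by simp
  qed
  also have "\<dots> = tensor_map id Gamma_coproduct (Gamma_couple (couple_of t W F))"
    unfolding Gamma_couple_couple_of[OF data] tensor_map_sum_basis
    by (rule sum.cong) (simp_all add: Gamma_quot_couple[OF PowD] tensor_sum_basis_right del: Pow_iff)
  finally show ?thesis .
qed

lemma card_quot_arcs:
  assumes "F' \<subseteq> F"
  shows "couple_edges (couple_of (quotient_tree F' t) (apex F' ` W) (contract_arcs F' F)) = card F - card F'"
  using couple_edges_couple_of[OF couple_data_quotient[OF data assms]]
    card_contract_arcs[OF couple_dataD(6)[OF data] assms] by simp

text \<open>
  The counit kills every left factor that has an edge, which leaves the term of \<open>F' = {}\<close>, and there
  nothing is contracted.
\<close>

lemma Gamma_counit_left_couple:
  "form_left counit (Gamma_couple (couple_of t W F)) = (basis {#couple_of t W F#} :: 'k::field dtilde)"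
proof -
  have "form_left counit (Gamma_couple (couple_of t W F)) =
      (\<Sum>F'\<in>Pow F. scale (counit (basis (sub_couple F'))) (basis (quot_couple F' F)) :: 'k dtilde)"
    by (simp add: Gamma_couple_couple_of[OF data] form_left_def linear_setsum[OF scale_linear_lin_ext])
  also have "\<dots> = (\<Sum>F'\<in>Pow F. if F' = {} then basis (sub_couple F) else 0)"
  proof (rule sum.cong)
    fix F' assume "F' \<in> Pow F"
    then have "couple_edges (couple_of t W F') = 0 \<longleftrightarrow> F' = {}"
      using couple_edges_couple_of[OF couple_data_subset[OF data]] finite_subset[OF _ finite_arcs]
      by auto
    then show "scale (counit (basis (sub_couple F'))) (basis (quot_couple F' F)) =
        (if F' = {} then basis (sub_couple F) else 0 :: 'k dtilde)"
      by (auto simp: counit_def)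
  qed simp
  finally show ?thesis by (simp add: finite_arcs)
qed

text \<open>
  The right factor has \<open>card F - card F'\<close> edges, so only the term of \<open>F' = F\<close> is left.
\<close>

lemma Gamma_counit_right_couple:
  "form_right counit (Gamma_couple (couple_of t W F)) = (basis {#couple_of t W F#} :: 'k::field dtilde)"
proof -
  have "form_right counit (Gamma_couple (couple_of t W F)) =
      (\<Sum>F'\<in>Pow F. scale (counit (basis (quot_couple F' F))) (basis (sub_couple F')) :: 'k dtilde)"
    by (simp add: Gamma_couple_couple_of[OF data] form_right_def linear_setsum[OF scale_linear_lin_ext])
  also have "\<dots> = (\<Sum>F'\<in>Pow F. if F' = F then basis (sub_couple F) else 0)"
  proof (rule sum.cong)
    fix F' assume "F' \<in> Pow F"
    then have "F' \<subseteq> F" by simp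
    then have "card F - card F' = 0 \<longleftrightarrow> F' = F"
      using card_seteq[OF finite_arcs, of F'] by auto
    then show "scale (counit (basis (quot_couple F' F))) (basis (sub_couple F')) =
        (if F' = F then basis (sub_couple F) else 0 :: 'k dtilde)"
      using card_quot_arcs[OF \<open>F' \<subseteq> F\<close>] by (auto simp: counit_def)
  qed simp
  finally show ?thesis by (simp add: finite_arcs)
qed

lemma Gamma_degree_couple:
  assumes "(M, N) \<in> Poly_Mapping.keys (Gamma_couple (couple_of t W F) :: _ \<Rightarrow>\<^sub>0 'k::field)"
  shows "(\<Sum>c\<in>#M. couple_edges c) + (\<Sum>c\<in>#N. couple_edges c) = couple_edges (couple_of t W F)"
proof -
  have "(M, N) \<in> (\<Union>F'\<in>Pow F. Poly_Mapping.keys (basis (sub_couple F', quot_couple F' F) :: _ \<Rightarrow>\<^sub>0 'k))"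
    using assms unfolding Gamma_couple_couple_of[OF data] by (rule subsetD[OF keys_sum])
  then obtain F' where F': "F' \<subseteq> F" "M = sub_couple F'" "N = quot_couple F' F" by auto
  note couple_edges_couple_of[OF couple_data_subset[OF data F'(1)]] couple_edges_couple_of[OF data]
  then show ?thesis
    using card_quot_arcs[OF F'(1)] card_mono[OF finite_arcs F'(1)] by (simp add: F')
qed

end

lemma coproduct_on_generators_couples:
  "coproduct_on_generators (Gamma_couple :: couple \<Rightarrow> _ \<Rightarrow>\<^sub>0 'k::field)
     (\<lambda>c. if couple_edges c = 0 then 1 else 0) couple_edges"
proof (rule coproduct_on_generators.intro, fold Gamma_coproduct_def counit_def)
  fix c :: couple and M N
  obtain t W F where c: "couple_data t W F" "c = couple_of t W F" using couple_of_cases .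
  show "tensor_assoc (tensor_map Gamma_coproduct id (Gamma_couple c)) =
      (tensor_map id Gamma_coproduct (Gamma_couple c) :: _ \<Rightarrow>\<^sub>0 'k)"
    unfolding c(2) by (rule Gamma_coassoc_couple[OF c(1)])
  show "form_left counit (Gamma_couple c) = (basis {#c#} :: 'k dtilde)"
    unfolding c(2) by (rule Gamma_counit_left_couple[OF c(1)])
  show "form_right counit (Gamma_couple c) = (basis {#c#} :: 'k dtilde)"
    unfolding c(2) by (rule Gamma_counit_right_couple[OF c(1)])
  show "(\<Sum>c\<in>#M. couple_edges c) + (\<Sum>c\<in>#N. couple_edges c) = couple_edges c"
    if "(M, N) \<in> Poly_Mapping.keys (Gamma_couple c :: _ \<Rightarrow>\<^sub>0 'k)"
    using Gamma_degree_couple[OF c(1)] that c(2) by simp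
qed simp

theorem theorem2:
  shows "graded_bialgebra (\<lambda>a b :: 'k::field dtilde. a * b) (basis {#}) Gamma_coproduct counit edge_grading"
proof -
  interpret coproduct_on_generators "Gamma_couple :: couple \<Rightarrow> _ \<Rightarrow>\<^sub>0 'k"
    "\<lambda>c. if couple_edges c = 0 then 1 else 0" couple_edges
    Gamma_coproduct counit "\<lambda>M. \<Sum>c\<in>#M. couple_edges c"
    by (simp_all add: coproduct_on_generators_couples Gamma_coproduct_def counit_def)
  have "degree_space = edge_grading" by (auto simp: degree_space_def edge_grading_def)
  then show ?thesis using graded_bialgebra_of_generators by simp
qed

end
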